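(* Consider the $t$-indexed extreme shock model with possibly increasing threshold described in the context. Suppose that $$\lim_{t\to\infty}\frac{\bar F(\beta(t))}{\bar F(\gamma(t))}=g\in(0,1)\qquad\text{and}\qquad \lim_{t\to\infty}\frac{\bar F(\alpha(t)+b_k(t)-c_h(t))}{\bar F(\beta(t))}=a_h\in[0,1]\quad\text{for all }k,h\ge0,$$ i.e. the latter limits exist and do not depend on $k$. Let $\mu=E(Y_1)$ with $0<\mu<\infty$, and for $z>0$ put $z_\beta=z/\bar F(\beta(t))$ and $$1-H(z)=\sum_{l=0}^\infty\frac{z^l}{l!}e^{-z}\prod_{h=0}^{l-1}(1-a_h)$$ (the empty product being $1$). Then for every $z>0$, as $t\to\infty$, $$P\{\nu>z_\beta\}\to 1-H(z)\qquad\text{and}\qquad P\{T_\nu>z_\beta\}\to1-H(z/\mu).$$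
   Context: Let $(X_i,Y_i)$, $i\ge1$, be i.i.d. two-dimensional random vectors ($X_i$ and $Y_i$ of the same pair may be dependent), where $X_i$ is real (magnitude of the $i$-th shock) and $Y_i\ge0$ (time between the $(i-1)$-th and the $i$-th shock); $T_n=\sum_{i=1}^nY_i$, and $T_\infty=\infty$. Let $F(x)=P\{X_1<x\}$ and $\bar F(x)=1-F(x)=P\{X_1\ge x\}$; let $x_F\le\infty$ be the upper endpoint of the distribution of $X_1$, assumed to be a continuity point of $F$. For each $t$ let $\gamma=\gamma(t)\le\beta=\beta(t)\le\alpha=\alpha(t)$ be real numbers, with $\bar F(\beta(t))>0$, and all three tending to $x_F$ as $t\to\infty$ (so $\bar F(\beta(t))\to0$). For each $t$ let $(b_k)_{k\ge0}=(b_k(t))$ and $(c_l)_{l\ge0}=(c_l(t))$ be nondecreasing real sequences with $b_0=c_0=0$, $b_1>0$, such that $\alpha+b_k-c_l\ge\beta$ for all $k,l\ge0$. For each $t$ define recursively $N_-(0)=N_+(0)=0$ and, for $n\ge1$, the number of weakening shocks before the $n$-th shock $$N_-(n)=\sum_{1\le i<n}1\{X_i\in[\beta,\ \alpha+b_{N_+(i)}-c_{N_-(i)})\},$$ and the number of strengthening shocks before the $n$-th shock (and before the first weakening shock) $$N_+(n)=\sum_{1\le i<n}1\{X_i\in[\gamma,\beta),\ N_-(i)=0\}.$$ The index of the first fatal shock is $\nu=\nu(t)=\min\{i\ge1:X_i\ge\alpha+b_{N_+(i)}-c_{N_-(i)}\}$ (with value $\infty$ if the set is empty), and $T_\nu$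 is the failure time. *)

theory Defs
  imports "HOL-Probability.Probability"
begin

text \<open>The convention here is \<open>F x = P (X < x)\<close> (left-continuous), so the library's right-continuous
  \<^const>\<open>cdf\<close> cannot be used.\<close>

definition left_cdf :: "'a measure \<Rightarrow> ('a \<Rightarrow> real) \<Rightarrow> real \<Rightarrow> real" where
  "left_cdf M X x = measure M {\<omega> \<in> space M. X \<omega> < x}"

definition tail :: "'a measure \<Rightarrow> ('a \<Rightarrow> real) \<Rightarrow> real \<Rightarrow> real" where
  "tail M X x = 1 - left_cdf M X x"

lemma (in prob_space) tail_eq_prob_ge:
  assumes "X \<in> borel_measurable M"
  shows "tail M X x = prob {\<omega> \<in> space M. X \<omega> \<ge> x}"
proof -
  have "{\<omega> \<in> space M. X \<omega> < x} \<in> events"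
    using assms by measurable
  moreover have "space M - {\<omega> \<in> space M. X \<omega> < x} = {\<omega> \<in> space M. X \<omega> \<ge> x}"
    by auto
  ultimately show ?thesis
    using prob_compl[of "{\<omega> \<in> space M. X \<omega> < x}"] by (simp add: tail_def left_cdf_def)
qed

definition upper_endpoint :: "'a measure \<Rightarrow> ('a \<Rightarrow> real) \<Rightarrow> ereal" where
  "upper_endpoint M X = Sup (ereal ` {x. left_cdf M X x < 1})"

text \<open>For a sequence \<open>x\<close> of shock magnitudes, numbered from 1 (the value \<open>x 0\<close> is never used),
  the numbers of weakening and of strengthening shocks before the \<open>n\<close>-th shock.\<close>

fun n_minus n_plus ::
  "real \<Rightarrow> real \<Rightarrow> real \<Rightarrow> (nat \<Rightarrow> real) \<Rightarrow> (nat \<Rightarrow> real) \<Rightarrow> (nat \<Rightarrow> real) \<Rightarrow> nat \<Rightarrow> nat" where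
  "n_minus \<gamma> \<beta> \<alpha> b c x n =
     (\<Sum>i = 1..<n. of_bool (x i \<in> {\<beta>..<\<alpha> + b (n_plus \<gamma> \<beta> \<alpha> b c x i) - c (n_minus \<gamma> \<beta> \<alpha> b c x i)}))"
| "n_plus \<gamma> \<beta> \<alpha> b c x n =
     (\<Sum>i = 1..<n. of_bool (x i \<in> {\<gamma>..<\<beta>} \<and> n_minus \<gamma> \<beta> \<alpha> b c x i = 0))"

text \<open>The recursive equations are unguarded and would make the simplifier loop.\<close>
declare n_minus.simps [simp del] n_plus.simps [simp del]

text \<open>The infimum of the empty set in \<^typ>\<open>enat\<close> is \<open>\<infinity>\<close>.\<close>

definition fatal_index ::
  "real \<Rightarrow> real \<Rightarrow> real \<Rightarrow> (nat \<Rightarrow> real) \<Rightarrow> (nat \<Rightarrow> real) \<Rightarrow> (nat \<Rightarrow> real) \<Rightarrow> enat" where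
  "fatal_index \<gamma> \<beta> \<alpha> b c x =
     Inf (enat ` {i. 1 \<le> i \<and> x i \<ge> \<alpha> + b (n_plus \<gamma> \<beta> \<alpha> b c x i) - c (n_minus \<gamma> \<beta> \<alpha> b c x i)})"

fun shock_time :: "(nat \<Rightarrow> real) \<Rightarrow> enat \<Rightarrow> ereal" where
  "shock_time y (enat n) = ereal (\<Sum>i = 1..n. y i)"
| "shock_time y \<infinity> = \<infinity>"

definition limit_df :: "(nat \<Rightarrow> real) \<Rightarrow> real \<Rightarrow> real" where
  "limit_df a z = 1 - (\<Sum>l. z ^ l / fact l * exp (- z) * (\<Prod>h<l. 1 - a h))"

end

theory Submission
  imports Defs
begin

text \<open>As long as no fatal shock has occurred, \<open>n_minus\<close> simply counts the shocks \<open>\<ge> \<beta>\<close>. Let \<open>\<nu>\<^sub>k\<close> be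
  the fatal index of the model whose strengthening count is frozen at \<open>k\<close>. Since \<open>b\<close> is nondecreasing,
  \<open>P (\<nu>\<^sub>0 > n) \<le> P (\<nu> > n) \<le> P (\<nu>\<^sub>K > n) + P (more than K of the first n shocks are \<ge> \<gamma>)\<close>.
  With \<open>p\<close> and \<open>q\<^sub>h\<close> the tails at \<open>\<beta>\<close> and \<open>\<alpha> + b\<^sub>k - c\<^sub>h\<close>, the law of the frozen model is explicit,
  \<open>P (\<nu>\<^sub>k > n) = (\<Sum>j\<le>n. (n choose j) (1 - p)^(n - j) (\<Prod>h<j. p - q\<^sub>h))\<close>,
  and for \<open>n \<approx> z / p\<close> Tannery's theorem gives the limit \<open>1 - H z\<close> for every \<open>k\<close>. By Markov's
  inequality the error term is asymptotically at most \<open>z / (g (K + 1))\<close>, which vanishes as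
  \<open>K \<rightarrow> \<infinity>\<close>. The limit of the failure time follows from the weak law of large numbers, the
  monotonicity of the partial sums of \<open>Y\<close> and the continuity of \<open>H\<close>.\<close>

section \<open>Weak law of large numbers\<close>

context prob_space
begin

text \<open>Only a first moment is assumed, so the variables are truncated at a level
  \<open>K\<close>. Hoeffding's inequality handles the averages of the bounded parts, and Markov's
  inequality handles the average truncation error, whose mean is small for large
  \<open>K\<close>.\<close>

lemma weak_law_of_large_numbers:
  fixes Z :: "nat \<Rightarrow> 'a \<Rightarrow> real"
  assumes indep: "indep_vars (\<lambda>_. borel) Z {1..}"
    and ident: "\<And>i. i \<ge> 1 \<Longrightarrow> distr M borel (Z i) = distr M borel (Z 1)"
    and int: "integrable M (Z 1)"
    and \<epsilon>: "\<epsilon> > 0"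
  shows "(\<lambda>n. prob {\<omega> \<in> space M. \<bar>(\<Sum>i=1..n. Z i \<omega>) / n - expectation (Z 1)\<bar> \<ge> \<epsilon>}) \<longlonglongrightarrow> 0"
proof (rule LIMSEQ_I)
  \<comment> \<open>Keeps \<open>Z 1\<close> from being rewritten to \<open>Z (Suc 0)\<close>, so
    that facts about it continue to match.\<close>
  note One_nat_def [simp del]
  fix \<delta> :: real assume \<delta>: "\<delta> > 0"
  have Z_meas: "random_variable borel (Z i)" if "i \<ge> 1" for i
    using indep that by (auto simp: indep_vars_def)
  define clamp where "clamp = (\<lambda>K z::real. max (-K) (min K z))"
  have clamp_meas [measurable]: "clamp K \<in> borel_measurable borel" for K
    unfolding clamp_def by measurable
  have [measurable]: "random_variable borel (Z 1)" by (simp add: Z_meas)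
  have transfer: "expectation (\<lambda>\<omega>. f (Z i \<omega>)) = expectation (\<lambda>\<omega>. f (Z 1 \<omega>))"
      "integrable M (\<lambda>\<omega>. f (Z i \<omega>)) = integrable M (\<lambda>\<omega>. f (Z 1 \<omega>))"
    if "i \<ge> 1" and [measurable]: "f \<in> borel_measurable borel" for i and f :: "real \<Rightarrow> real"
  proof -
    have [measurable]: "random_variable borel (Z i)" using that Z_meas by simp
    show "expectation (\<lambda>\<omega>. f (Z i \<omega>)) = expectation (\<lambda>\<omega>. f (Z 1 \<omega>))"
      using integral_distr[of "Z i" M borel f] integral_distr[of "Z 1" M borel f] ident[of i] that by simp
    show "integrable M (\<lambda>\<omega>. f (Z i \<omega>)) = integrable M (\<lambda>\<omega>. f (Z 1 \<omega>))"
      using integrable_distr_eq[of "Z i" M borel f] integrable_distr_eq[of "Z 1" M borel f] ident[of i] that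
      by simp
  qed
  define \<mu> where "\<mu> = expectation (Z 1)"
  have clamp_err: "\<bar>z - clamp K z\<bar> \<le> \<bar>z\<bar>" if "K \<ge> 0" for K z
    using that by (auto simp: clamp_def)
  have "((\<lambda>K. expectation (\<lambda>\<omega>. \<bar>Z 1 \<omega> - clamp K (Z 1 \<omega>)\<bar>)) \<longlongrightarrow> expectation (\<lambda>\<omega>. 0)) at_top"
  proof (rule integral_dominated_convergence_at_top[where w="\<lambda>\<omega>. \<bar>Z 1 \<omega>\<bar>"])
    show "AE \<omega> in M. ((\<lambda>K. \<bar>Z 1 \<omega> - clamp K (Z 1 \<omega>)\<bar>) \<longlongrightarrow> 0) at_top"
    proof (rule AE_I2)
      fix \<omega>
      have "eventually (\<lambda>K. \<bar>Z 1 \<omega> - clamp K (Z 1 \<omega>)\<bar> = 0) at_top"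
        using eventually_ge_at_top[of "\<bar>Z 1 \<omega>\<bar>"] by eventually_elim (auto simp: clamp_def)
      then show "((\<lambda>K. \<bar>Z 1 \<omega> - clamp K (Z 1 \<omega>)\<bar>) \<longlongrightarrow> 0) at_top"
        by (rule tendsto_eventually)
    qed
    show "eventually (\<lambda>K. AE \<omega> in M. norm \<bar>Z 1 \<omega> - clamp K (Z 1 \<omega>)\<bar> \<le> \<bar>Z 1 \<omega>\<bar>) at_top"
      using eventually_ge_at_top[of 0] by eventually_elim (auto intro!: AE_I2 clamp_err)
  qed (use int in auto)
  \<comment> \<open>The bound \<open>\<epsilon> / 3\<close> will control the shift of the mean; the
    bound \<open>\<delta> * \<epsilon> / 6\<close> makes the Markov quotient by
    \<open>\<epsilon> / 3\<close> at most \<open>\<delta> / 2\<close>.\<close>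
  then have "eventually (\<lambda>K. expectation (\<lambda>\<omega>. \<bar>Z 1 \<omega> - clamp K (Z 1 \<omega>)\<bar>)
      < min (\<epsilon> / 3) (\<delta> * \<epsilon> / 6)) at_top"
    using \<epsilon> \<delta> by (intro order_tendstoD(2)) auto
  then obtain K where K: "K > 0"
      "expectation (\<lambda>\<omega>. \<bar>Z 1 \<omega> - clamp K (Z 1 \<omega>)\<bar>) < min (\<epsilon> / 3) (\<delta> * \<epsilon> / 6)"
    using eventually_conj[OF eventually_gt_at_top[of "0::real"]] eventually_happens'[OF trivial_limit_at_top_linorder]
    by (metis (mono_tags, lifting))
  define err where "err = (\<lambda>z. \<bar>z - clamp K z\<bar>)"
  have [measurable]: "err \<in> borel_measurable borel" unfolding err_def by measurable
  define e where "e = expectation (\<lambda>\<omega>. err (Z 1 \<omega>))"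
  have e: "e < \<epsilon> / 3" "e < \<delta> * \<epsilon> / 6" using K by (auto simp: e_def err_def)
  have err_int: "integrable M (\<lambda>\<omega>. err (Z 1 \<omega>))"
    by (rule Bochner_Integration.integrable_bound[OF int])
       (use clamp_err[of K] K(1) in \<open>auto simp: err_def\<close>)
  have clamp_int: "integrable M (\<lambda>\<omega>. clamp K (Z 1 \<omega>))"
    by (rule integrable_const_bound[where B=K]) (use K in \<open>auto simp: clamp_def\<close>)
  define \<mu>' where "\<mu>' = expectation (\<lambda>\<omega>. clamp K (Z 1 \<omega>))"
  have \<mu>': "\<bar>\<mu> - \<mu>'\<bar> \<le> e"
  proof -
    have "\<mu> - \<mu>' = expectation (\<lambda>\<omega>. Z 1 \<omega> - clamp K (Z 1 \<omega>))"
      unfolding \<mu>_def \<mu>'_def using int clamp_int by simp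
    also have "\<bar>\<dots>\<bar> \<le> expectation (\<lambda>\<omega>. err (Z 1 \<omega>))"
      unfolding err_def by (rule integral_abs_bound)
    finally show ?thesis by (simp add: e_def)
  qed
  have bound: "prob {\<omega> \<in> space M. \<bar>(\<Sum>i=1..n. Z i \<omega>) / n - \<mu>\<bar> \<ge> \<epsilon>}
      \<le> 2 * exp (-2 * real n * (\<epsilon>/3)\<^sup>2 / (K - (-K))\<^sup>2) + \<delta> / 2" if n: "n \<ge> 1" for n
  proof -
    have [measurable]: "random_variable borel (Z i)" if "i \<in> {1..n}" for i
      using that Z_meas by simp
    interpret H: Hoeffding_ineq_iid M "{1..n}" "\<lambda>i \<omega>. clamp K (Z i \<omega>)" "\<lambda>\<omega>. clamp K (Z 1 \<omega>)" "-K" K \<mu>'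
    proof unfold_locales
      show "indep_vars (\<lambda>_. borel) (\<lambda>i \<omega>. clamp K (Z i \<omega>)) {1..n}"
        by (rule indep_vars_compose2[OF indep_vars_subset[OF indep]]) auto
      show "distr M borel (\<lambda>\<omega>. clamp K (Z i \<omega>)) = distr M borel (\<lambda>\<omega>. clamp K (Z 1 \<omega>))"
        if "i \<in> {1..n}" for i
      proof -
        have "distr M borel (\<lambda>\<omega>. clamp K (Z i \<omega>)) = distr (distr M borel (Z i)) borel (clamp K)"
          using that by (subst distr_distr) (auto simp: comp_def)
        also have "distr M borel (Z i) = distr M borel (Z 1)" using that by (intro ident) auto
        also have "distr \<dots> borel (clamp K) = distr M borel (\<lambda>\<omega>. clamp K (Z 1 \<omega>))"
          by (subst distr_distr) (auto simp: comp_def)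
        finally show ?thesis .
      qed
      show "AE x in M. clamp K (Z 1 x) \<in> {- K..K}"
        using K by (auto simp: clamp_def)
    qed (auto simp: \<mu>'_def)
    \<comment> \<open>The deviation has three parts: the average truncation error, the distance of
      the clamped average from its mean, and the distance of the two means. The last is below
      \<open>\<epsilon> / 3\<close> by the choice of \<open>K\<close>, so one of the other two must
      reach \<open>\<epsilon> / 3\<close>.\<close>
    let ?A = "{\<omega> \<in> space M. \<bar>(\<Sum>i=1..n. clamp K (Z i \<omega>)) / real n - \<mu>'\<bar> \<ge> \<epsilon>/3}"
    let ?B = "{\<omega> \<in> space M. (\<Sum>i=1..n. err (Z i \<omega>)) \<ge> n * (\<epsilon>/3)}"
    have int_i: "integrable M (\<lambda>\<omega>. err (Z i \<omega>))" if "i \<in> {1..n}" for i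
      using that err_int transfer(2)[of i err] by simp
    have "prob {\<omega> \<in> space M. \<bar>(\<Sum>i=1..n. Z i \<omega>) / n - \<mu>\<bar> \<ge> \<epsilon>} \<le> prob (?A \<union> ?B)"
    proof (rule finite_measure_mono)
      show "{\<omega> \<in> space M. \<bar>(\<Sum>i=1..n. Z i \<omega>) / n - \<mu>\<bar> \<ge> \<epsilon>} \<subseteq> ?A \<union> ?B"
      proof (rule subsetI, rule ccontr)
        fix \<omega> assume \<omega>_in: "\<omega> \<in> {\<omega> \<in> space M. \<bar>(\<Sum>i=1..n. Z i \<omega>) / n - \<mu>\<bar> \<ge> \<epsilon>}"
          and \<omega>_notin: "\<omega> \<notin> ?A \<union> ?B"
        then have \<omega>: "\<epsilon> \<le> \<bar>(\<Sum>i = 1..n. Z i \<omega>) / n - \<mu>\<bar>"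
            "(\<Sum>i = 1..n. err (Z i \<omega>)) < n * (\<epsilon> / 3)"
          by auto
        let ?c = "\<Sum>i = 1..n. clamp K (Z i \<omega>)"
        have "(\<Sum>i = 1..n. Z i \<omega>) / n - ?c / n = (\<Sum>i = 1..n. Z i \<omega> - clamp K (Z i \<omega>)) / n"
          by (simp add: sum_subtractf diff_divide_distrib)
        also have "\<bar>\<dots>\<bar> = \<bar>\<Sum>i = 1..n. Z i \<omega> - clamp K (Z i \<omega>)\<bar> / n" by simp
        also have "\<dots> \<le> (\<Sum>i = 1..n. err (Z i \<omega>)) / n"
          unfolding err_def by (intro divide_right_mono sum_abs) auto
        also have "\<dots> < \<epsilon> / 3" using \<omega>(2) n by (simp add: field_simps)
        finally have "\<bar>(\<Sum>i = 1..n. Z i \<omega>) / n - ?c / n\<bar> < \<epsilon> / 3" .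
        moreover have "\<epsilon> \<le> 3 * \<bar>v - \<mu>'\<bar>" if "\<bar>u - v\<bar> < \<epsilon> / 3" "\<epsilon> \<le> \<bar>u - \<mu>\<bar>" for u v
        proof -
          have "\<bar>u - \<mu>\<bar> \<le> \<bar>u - v\<bar> + \<bar>v - \<mu>'\<bar> + \<bar>\<mu> - \<mu>'\<bar>" by linarith
          with that \<mu>' e(1) show ?thesis by (simp add: field_simps)
        qed
        ultimately have "\<epsilon> \<le> 3 * \<bar>?c / n - \<mu>'\<bar>"
          using \<omega>(1) by blast
        then show False
          using \<omega>_in \<omega>_notin by simp
      qed
      show "?A \<union> ?B \<in> events" by measurable
    qed
    also have "\<dots> \<le> prob ?A + prob ?B"
      by (rule measure_Un_le) measurable
    also have "prob ?A \<le> 2 * exp (-2 * real n * (\<epsilon>/3)\<^sup>2 / (K - (-K))\<^sup>2)"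
      using H.Hoeffding_ineq_abs_ge'[of "\<epsilon>/3"] \<epsilon> K n by simp
    also have "prob ?B \<le> expectation (\<lambda>\<omega>. \<Sum>i=1..n. err (Z i \<omega>)) / (n * (\<epsilon>/3))"
    proof (rule integral_Markov_inequality_measure)
      show "integrable M (\<lambda>\<omega>. \<Sum>i=1..n. err (Z i \<omega>))" by (intro Bochner_Integration.integrable_sum int_i)
      show "{} \<in> events" by simp
    qed (use n \<epsilon> in \<open>auto simp: err_def intro!: AE_I2 sum_nonneg\<close>)
    also have "expectation (\<lambda>\<omega>. \<Sum>i=1..n. err (Z i \<omega>)) = n * e"
    proof -
      have "expectation (\<lambda>\<omega>. \<Sum>i=1..n. err (Z i \<omega>)) = (\<Sum>i=1..n. expectation (\<lambda>\<omega>. err (Z i \<omega>)))"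
        by (rule Bochner_Integration.integral_sum) (rule int_i)
      also have "\<dots> = (\<Sum>i=1..n. e)"
        unfolding e_def by (intro sum.cong refl transfer(1)) auto
      finally show ?thesis by simp
    qed
    also have "n * e / (n * (\<epsilon>/3)) \<le> \<delta> / 2"
      using n e \<epsilon> by (simp add: field_simps)
    finally show ?thesis by simp
  qed
  have lim0: "(\<lambda>n. 2 * exp (-2 * real n * (\<epsilon>/3)\<^sup>2 / (K - (-K))\<^sup>2)) \<longlonglongrightarrow> 0"
  proof -
    \<comment> \<open>The Hoeffding bound is geometric in \<open>n\<close>, with ratio
      \<open>r < 1\<close>.\<close>
    define r where "r = exp (-2 * (\<epsilon>/3)\<^sup>2 / (K - (-K))\<^sup>2)"
    have "r < 1" using \<epsilon> K(1) by (simp add: r_def)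
    then have "(\<lambda>n. 2 * r ^ n) \<longlonglongrightarrow> 2 * 0"
      by (intro tendsto_intros LIMSEQ_realpow_zero) (auto simp: r_def)
    then show ?thesis by (simp add: r_def exp_of_nat_mult[symmetric] mult_ac)
  qed
  have "eventually (\<lambda>n. 2 * exp (-2 * real n * (\<epsilon>/3)\<^sup>2 / (K - (-K))\<^sup>2) < \<delta> / 2) sequentially"
    using order_tendstoD(2)[OF lim0, of "\<delta> / 2"] \<delta> by simp
  with eventually_ge_at_top[of 1]
  have "eventually (\<lambda>n. prob {\<omega> \<in> space M. \<bar>(\<Sum>i=1..n. Z i \<omega>) / n - \<mu>\<bar> \<ge> \<epsilon>} < \<delta>) sequentially"
    by eventually_elim (use bound in force)
  then show "\<exists>n0. \<forall>n\<ge>n0. norm (prob {\<omega> \<in> space M. \<bar>(\<Sum>i=1..n. Z i \<omega>) / n - expectation (Z 1)\<bar> \<ge> \<epsilon>} - 0) < \<delta>"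
    by (auto simp: eventually_sequentially \<mu>_def)
qed

end

section \<open>Limits of thinned binomial sums\<close>

text \<open>Both sandwich bounds come from \<open>1 + x \<le> exp x\<close>: the upper one with
  \<open>x = - p t\<close>, the lower one with \<open>x = p t / (1 - p t)\<close> after taking
  reciprocals.\<close>

lemma one_minus_power_tendsto:
  fixes p :: "'b \<Rightarrow> real" and n :: "'b \<Rightarrow> nat"
  assumes p0: "(p \<longlongrightarrow> 0) F" and p_pos: "\<And>t. p t > 0"
    and np: "((\<lambda>t. n t * p t) \<longlongrightarrow> s) F"
  shows "((\<lambda>t. (1 - p t) ^ n t) \<longlongrightarrow> exp (- s)) F"
proof (rule tendsto_sandwich)
  have small: "eventually (\<lambda>t. p t < 1) F"
    using p0 by (rule order_tendstoD) simp
  show "eventually (\<lambda>t. exp (- (n t * p t / (1 - p t))) \<le> (1 - p t) ^ n t) F"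
    using small
  proof eventually_elim
    case (elim t)
    have "1 / (1 - p t) \<le> exp (p t / (1 - p t))"
      using exp_ge_add_one_self[of "p t / (1 - p t)"] elim by (simp add: field_simps)
    then have "exp (- (p t / (1 - p t))) \<le> 1 - p t"
      using elim by (simp add: exp_minus field_simps)
    then have "exp (- (p t / (1 - p t))) ^ n t \<le> (1 - p t) ^ n t"
      by (intro power_mono) auto
    then show ?case by (simp add: exp_of_nat_mult[symmetric] mult_ac)
  qed
  show "eventually (\<lambda>t. (1 - p t) ^ n t \<le> exp (- (n t * p t))) F"
    using small
  proof eventually_elim
    case (elim t)
    have "(1 - p t) ^ n t \<le> exp (- p t) ^ n t"
      using exp_ge_add_one_self[of "- p t"] elim by (intro power_mono) auto
    then show ?case by (simp add: exp_of_nat_mult[symmetric] mult_ac)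
  qed
  have "((\<lambda>t. exp (- (n t * p t / (1 - p t)))) \<longlongrightarrow> exp (- (s / (1 - 0)))) F"
    using p0 np by (intro tendsto_intros) auto
  then show "((\<lambda>t. exp (- (n t * p t / (1 - p t)))) \<longlongrightarrow> exp (- s)) F" by simp
  show "((\<lambda>t. exp (- (n t * p t))) \<longlongrightarrow> exp (- s)) F"
    using np by (intro tendsto_intros)
qed

text \<open>For fixed \<open>N\<close>, the product \<open>N * p t\<close> vanishes while
  \<open>n t * p t\<close> stays above \<open>s / 2\<close>.\<close>

lemma filterlim_at_top_if_scaled_tendsto:
  fixes p :: "'b \<Rightarrow> real" and n :: "'b \<Rightarrow> nat"
  assumes p0: "(p \<longlongrightarrow> 0) F" and p_pos: "\<And>t. p t > 0"
    and np: "((\<lambda>t. n t * p t) \<longlongrightarrow> s) F" and s: "s > 0"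
  shows "filterlim n at_top F"
proof (unfold filterlim_at_top, intro allI)
  fix N :: nat
  have "eventually (\<lambda>t. real N * p t < s / 2) F"
    using order_tendstoD(2)[OF tendsto_mult_right_zero[OF p0], of "s / 2" "real N"] s by simp
  moreover have "eventually (\<lambda>t. n t * p t > s / 2) F"
    using np s by (intro order_tendstoD) auto
  ultimately show "eventually (\<lambda>t. n t \<ge> N) F"
  proof eventually_elim
    case (elim t)
    then have "real N * p t < n t * p t" by simp
    then show ?case using p_pos[of t] by simp
  qed
qed

text \<open>Rounding down changes \<open>s / p t\<close> by at most one, hence the product by at
  most \<open>p t\<close>.\<close>

lemma floor_scaled_tendsto:
  fixes p :: "'b \<Rightarrow> real"
  assumes p0: "(p \<longlongrightarrow> 0) F" and p_pos: "\<And>t. p t > 0" and s: "s > 0"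
  shows "((\<lambda>t. nat \<lfloor>s / p t\<rfloor> * p t) \<longlongrightarrow> s) F"
proof (rule tendsto_sandwich)
  have floor: "real (nat \<lfloor>s / p t\<rfloor>) \<le> s / p t" "s / p t - 1 \<le> real (nat \<lfloor>s / p t\<rfloor>)" for t
    using s p_pos[of t] by (auto intro: of_nat_floor)
  show "eventually (\<lambda>t. s - p t \<le> nat \<lfloor>s / p t\<rfloor> * p t) F"
    using floor(2) p_pos by (intro always_eventually allI) (simp add: field_simps)
  show "eventually (\<lambda>t. nat \<lfloor>s / p t\<rfloor> * p t \<le> s) F"
    using floor(1) p_pos by (intro always_eventually allI) (simp add: field_simps)
  show "((\<lambda>t. s - p t) \<longlongrightarrow> s) F"
    using tendsto_diff[OF tendsto_const p0, of s] by simp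
qed simp

text \<open>This is Poisson's limit theorem with weights: once a factor \<open>p t\<close> is taken
  out, \<open>p t - q t h\<close> leaves \<open>1 - a h\<close> in the limit. Each summand converges
  to its Poisson counterpart, and a summable majorant lets the limit pass through the sum.\<close>

lemma binomial_thinned_tendsto:
  fixes p :: "'b \<Rightarrow> real" and n :: "'b \<Rightarrow> nat" and q :: "'b \<Rightarrow> nat \<Rightarrow> real"
  assumes F: "F \<noteq> bot"
    and p0: "(p \<longlongrightarrow> 0) F" and p: "\<And>t. p t > 0" "\<And>t. p t \<le> 1"
    and np: "((\<lambda>t. n t * p t) \<longlongrightarrow> s) F" and s: "s > 0"
    and q: "\<And>t h. 0 \<le> q t h" "\<And>t h. q t h \<le> p t"
    and q_lim: "\<And>h. ((\<lambda>t. q t h / p t) \<longlongrightarrow> a h) F"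
  shows "((\<lambda>t. \<Sum>j\<le>n t. (n t choose j) * (1 - p t) ^ (n t - j) * (\<Prod>h<j. p t - q t h))
    \<longlongrightarrow> 1 - limit_df a s) F"
proof -
  define f where "f = (\<lambda>j t. (n t choose j) * (1 - p t) ^ (n t - j) * (\<Prod>h<j. p t - q t h))"
  have n_lim: "filterlim n at_top F"
    using p0 p(1) np s by (rule filterlim_at_top_if_scaled_tendsto)
  have lim: "(f j \<longlongrightarrow> s ^ j / fact j * exp (- s) * (\<Prod>h<j. 1 - a h)) F" for j
  proof -
    \<comment> \<open>The factor \<open>p t ^ j\<close> is divided out of the last product and
      absorbed by the falling factorial of \<open>n t\<close>, so that every factor has a limit.
      Splitting the power needs \<open>j \<le> n t\<close> and \<open>p t < 1\<close>; both hold
      eventually.\<close>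
    have "eventually (\<lambda>t. ((\<Prod>i<j. n t * p t - i * p t) / fact j) * ((1 - p t) ^ n t / (1 - p t) ^ j)
        * (\<Prod>h<j. 1 - q t h / p t) = f j t) F"
      using filterlim_at_top[THEN iffD1, OF n_lim, rule_format, of j] order_tendstoD(2)[OF p0 zero_less_one]
    proof eventually_elim
      case (elim t)
      have "(\<Prod>i<j. n t * p t - i * p t) = p t ^ j * (\<Prod>i<j. real (n t) - real i)"
      proof -
        have "n t * p t - i * p t = p t * (real (n t) - real i)" for i
          by (simp add: algebra_simps)
        then show ?thesis by (simp add: prod.distrib)
      qed
      moreover have "(\<Prod>i<j. real (n t) - real i) / fact j = n t choose j"
        by (simp add: binomial_gbinomial gbinomial_prod_rev lessThan_atLeast0)
      ultimately have 1: "(\<Prod>i<j. n t * p t - i * p t) / fact j = p t ^ j * (n t choose j)"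
        by (simp add: field_simps)
      have 2: "(1 - p t) ^ n t / (1 - p t) ^ j = (1 - p t) ^ (n t - j)"
        using elim by (simp add: power_diff)
      have "p t * (1 - q t h / p t) = p t - q t h" for h
        using p(1)[of t] by (simp add: field_simps)
      then have 3: "p t ^ j * (\<Prod>h<j. 1 - q t h / p t) = (\<Prod>h<j. p t - q t h)"
        using prod.distrib[of "\<lambda>_. p t" "\<lambda>h. 1 - q t h / p t" "{..<j}"] by simp
      show ?case unfolding 1 2 f_def 3[symmetric] by simp
    qed
    moreover have "((\<lambda>t. ((\<Prod>i<j. n t * p t - i * p t) / fact j) * ((1 - p t) ^ n t / (1 - p t) ^ j)
        * (\<Prod>h<j. 1 - q t h / p t)) \<longlongrightarrow>
        ((\<Prod>i<j. s - i * 0) / fact j) * (exp (- s) / (1 - 0) ^ j) * (\<Prod>h<j. 1 - a h)) F"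
      using tendsto_mult_right_zero[OF p0]
      by (intro tendsto_intros one_minus_power_tendsto np p0 p q_lim) auto
    ultimately show ?thesis
      by (simp add: tendsto_cong)
  qed
  have "eventually (\<lambda>t. n t * p t < s + 1) F"
    using np by (rule order_tendstoD) simp
  \<comment> \<open>The binomial coefficient is at most \<open>n t ^ j / fact j\<close> and the
    product at most \<open>p t ^ j\<close>, which gives \<open>(n t * p t) ^ j / fact j\<close>. The
    restriction \<open>n t * p t < s + 1\<close> on \<open>t\<close> is the same for all
    \<open>j\<close>, as Tannery's theorem requires.\<close>
  then have bound: "eventually (\<lambda>t. \<forall>j. norm (f j t) \<le> (s + 1) ^ j / fact j) F"
  proof (eventually_elim, intro allI)
    fix t j assume t: "n t * p t < s + 1"
    have "(\<Prod>h<j. p t - q t h) \<le> (\<Prod>h<j. p t)"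
      using q by (intro prod_mono) auto
    then have prod: "0 \<le> (\<Prod>h<j. p t - q t h)" "(\<Prod>h<j. p t - q t h) \<le> p t ^ j"
      using q by (auto intro!: prod_nonneg)
    have "norm (f j t) = (n t choose j) * (1 - p t) ^ (n t - j) * (\<Prod>h<j. p t - q t h)"
      using prod(1) p by (simp add: f_def abs_mult)
    also have "\<dots> \<le> real (n t choose j) * 1 * p t ^ j"
    proof (intro mult_mono)
      show "(1 - p t) ^ (n t - j) \<le> 1" using p[of t] by (intro power_le_one) auto
    qed (use prod p in \<open>auto simp: less_imp_le\<close>)
    also have "\<dots> \<le> (n t ^ j / fact j) * p t ^ j"
    proof (intro mult_right_mono)
      have "real ((n t choose j) * fact j) \<le> real (n t ^ j)"
        by (rule of_nat_mono[OF binomial_fact_pow])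
      then show "real (n t choose j) * 1 \<le> n t ^ j / (fact j :: real)"
        by (simp add: field_simps)
    qed (use p in \<open>simp add: less_imp_le\<close>)
    also have "\<dots> = (n t * p t) ^ j / fact j" by (simp add: power_mult_distrib)
    also have "\<dots> \<le> (s + 1) ^ j / fact j"
      using t p(1)[of t] by (intro divide_right_mono power_mono) auto
    finally show "norm (f j t) \<le> (s + 1) ^ j / fact j" .
  qed
  have "((\<lambda>t. \<Sum>j. f j t) \<longlongrightarrow> (\<Sum>j. s ^ j / fact j * exp (- s) * (\<Prod>h<j. 1 - a h))) F"
  proof (rule tannerys_theorem[THEN conjunct2, THEN conjunct2, OF lim _ _ F])
    show "eventually (\<lambda>(j, t). norm (f j t) \<le> (s + 1) ^ j / fact j) (at_top \<times>\<^sub>F F)"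
      using eventually_prodI[OF eventually_True bound] by (rule eventually_mono) auto
    show "summable (\<lambda>j. (s + 1) ^ j / fact j)"
      using summable_exp[of "s + 1"] by (simp add: field_simps)
  qed
  \<comment> \<open>The binomial coefficient vanishes for \<open>j > n t\<close>.\<close>
  moreover have "(\<Sum>j. f j t) = (\<Sum>j\<le>n t. f j t)" for t
    by (rule suminf_finite) (auto simp: f_def)
  ultimately show ?thesis by (simp add: f_def limit_df_def)
qed

text \<open>Once \<open>exp (- z)\<close> is factored out, a power series remains whose coefficients
  are at most \<open>1 / fact l\<close> in absolute value, so it converges everywhere. Continuity is
  what lets the failure time be compared with shock indices scaled slightly off
  \<open>z / \<mu>\<close>.\<close>

lemma isCont_limit_df:
  assumes a: "\<And>h. a h \<in> {0..1}"
  shows "isCont (limit_df a) z"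
proof -
  define w where "w = (\<lambda>l. (\<Prod>h<l. 1 - a h) / fact l)"
  have w: "\<bar>w l\<bar> \<le> 1 / fact l" for l
    using a unfolding w_def abs_divide abs_prod
    by (intro divide_mono) (auto intro!: prod_le_1 prod_nonneg)
  have summ: "summable (\<lambda>l. w l * z ^ l)" for z
  proof (rule summable_comparison_test')
    show "summable (\<lambda>l. inverse (fact l) * \<bar>z\<bar> ^ l)" by (rule summable_exp)
    show "norm (w l * z ^ l) \<le> inverse (fact l) * \<bar>z\<bar> ^ l" if "l \<ge> 0" for l
      using mult_right_mono[OF w[of l], of "\<bar>z\<bar> ^ l"] by (simp add: abs_mult power_abs inverse_eq_divide)
  qed
  have "limit_df a z = 1 - exp (- z) * (\<Sum>l. w l * z ^ l)" for z
    using suminf_mult[OF summ[of z], of "exp (- z)"] by (simp add: limit_df_def w_def mult_ac)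
  then have "limit_df a = (\<lambda>z. 1 - exp (- z) * (\<Sum>l. w l * z ^ l))"
    by blast
  moreover have "isCont (\<lambda>z. \<Sum>l. w l * z ^ l) z"
    by (rule isCont_powser[OF summ, where K="\<bar>z\<bar> + 1"]) simp
  ultimately show ?thesis by simp
qed

section \<open>Shock model with frozen strengthening count\<close>

text \<open>Unlike \<open>n_minus\<close>, this count refers to no moving threshold, which makes it
  a sum of independent indicators; the two counts agree up to the first fatal shock. Shock
  \<open>n\<close> itself is excluded, so the first \<open>n\<close> shocks are counted at
  \<open>Suc n\<close>.\<close>

definition exceedances :: "real \<Rightarrow> (nat \<Rightarrow> real) \<Rightarrow> nat \<Rightarrow> nat" where
  "exceedances \<beta> x n = (\<Sum>i=1..<n. of_bool (x i \<ge> \<beta>))"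

lemma exceedances_1 [simp]: "exceedances \<beta> x (Suc 0) = 0"
  by (simp add: exceedances_def)

lemma exceedances_Suc:
  "n \<ge> 1 \<Longrightarrow> exceedances \<beta> x (Suc n) = exceedances \<beta> x n + of_bool (x n \<ge> \<beta>)"
  by (simp add: exceedances_def)

lemma exceedances_Suc_le: "exceedances \<beta> x (Suc n) \<le> n"
proof -
  have "exceedances \<beta> x (Suc n) \<le> (\<Sum>i=1..<Suc n. 1)"
    unfolding exceedances_def by (intro sum_mono) auto
  then show ?thesis by simp
qed

lemma n_minus_Suc:
  assumes "n \<ge> 1"
  shows "n_minus \<gamma> \<beta> \<alpha> b c x (Suc n) =
    (if \<beta> \<le> x n \<and> x n < \<alpha> + b (n_plus \<gamma> \<beta> \<alpha> b c x n) - c (n_minus \<gamma> \<beta> \<alpha> b c x n)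
     then Suc (n_minus \<gamma> \<beta> \<alpha> b c x n) else n_minus \<gamma> \<beta> \<alpha> b c x n)"
proof -
  have "{1..<Suc n} = insert n {1..<n}" using assms by auto
  \<comment> \<open>Fixing the last argument unfolds only these two calls; the calls at the
    summation index stay folded, so the rewriting terminates.\<close>
  then show ?thesis
    by (simp add: n_minus.simps[of _ _ _ _ _ _ "Suc n"] n_minus.simps[of _ _ _ _ _ _ n])
qed

lemma n_plus_Suc:
  assumes "n \<ge> 1"
  shows "n_plus \<gamma> \<beta> \<alpha> b c x (Suc n) =
    (if \<gamma> \<le> x n \<and> x n < \<beta> \<and> n_minus \<gamma> \<beta> \<alpha> b c x n = 0
     then Suc (n_plus \<gamma> \<beta> \<alpha> b c x n) else n_plus \<gamma> \<beta> \<alpha> b c x n)"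
proof -
  have "{1..<Suc n} = insert n {1..<n}" using assms by auto
  then show ?thesis
    by (simp add: n_plus.simps[of _ _ _ _ _ _ "Suc n"] n_plus.simps[of _ _ _ _ _ _ n])
qed

lemma n_minus_n_plus_initial:
  "n_minus \<gamma> \<beta> \<alpha> b c x 0 = 0" "n_plus \<gamma> \<beta> \<alpha> b c x 0 = 0"
  "n_minus \<gamma> \<beta> \<alpha> b c x (Suc 0) = 0" "n_plus \<gamma> \<beta> \<alpha> b c x (Suc 0) = 0"
  by (simp_all add: n_minus.simps[where n = 0] n_minus.simps[where n = "Suc 0"]
      n_plus.simps[where n = 0] n_plus.simps[where n = "Suc 0"])

text \<open>Being strictly below the infimum means that \<open>Suc n\<close> is a lower bound of the
  set. This form needs no case distinction for an infinite fatal index and turns survival into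
  finitely many conditions.\<close>

lemma less_fatal_index_iff:
  "enat n < fatal_index \<gamma> \<beta> \<alpha> b c x \<longleftrightarrow>
    (\<forall>i\<in>{1..n}. x i < \<alpha> + b (n_plus \<gamma> \<beta> \<alpha> b c x i) - c (n_minus \<gamma> \<beta> \<alpha> b c x i))"
proof -
  define thr where "thr = (\<lambda>i. \<alpha> + b (n_plus \<gamma> \<beta> \<alpha> b c x i) - c (n_minus \<gamma> \<beta> \<alpha> b c x i))"
  have "enat n < Inf (enat ` {i. 1 \<le> i \<and> x i \<ge> thr i}) \<longleftrightarrow> (\<forall>i. 1 \<le> i \<longrightarrow> x i \<ge> thr i \<longrightarrow> Suc n \<le> i)"
    unfolding Suc_ile_eq[symmetric] le_Inf_iff by auto
  also have "\<dots> \<longleftrightarrow> (\<forall>i\<in>{1..n}. x i < thr i)"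
    by (meson atLeastAtMost_iff not_le not_less_eq_eq)
  finally show ?thesis by (simp add: fatal_index_def thr_def)
qed

text \<open>Before the first fatal shock, the upper end of the interval counted by
  \<open>n_minus\<close> excludes nothing.\<close>

lemma n_minus_eq_exceedances:
  assumes "\<forall>i\<in>{1..<n}. x i < \<alpha> + b (n_plus \<gamma> \<beta> \<alpha> b c x i) - c (n_minus \<gamma> \<beta> \<alpha> b c x i)"
  shows "n_minus \<gamma> \<beta> \<alpha> b c x n = exceedances \<beta> x n"
  unfolding exceedances_def n_minus.simps[of _ _ _ _ _ _ n]
  using assms by (intro sum.cong) auto

lemma n_plus_le_exceedances: "n_plus \<gamma> \<beta> \<alpha> b c x n \<le> exceedances \<gamma> x n"
  unfolding exceedances_def n_plus.simps[of _ _ _ _ _ _ n]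
  by (intro sum_mono) auto

lemma exceedances_mono: "m \<le> n \<Longrightarrow> exceedances \<beta> x m \<le> exceedances \<beta> x n"
  unfolding exceedances_def by (intro sum_mono2) auto

text \<open>The lower half of the comparison: freezing \<open>b\<close> at \<open>b 0\<close> gives
  the lowest thresholds, so survival there implies survival in the true model. Strong induction is
  used because replacing \<open>n_minus\<close> by \<open>exceedances\<close> at shock
  \<open>i\<close> presupposes that the true model has survived all earlier shocks.\<close>

lemma less_fatal_indexI:
  assumes b: "incseq b"
    and alive: "\<forall>i\<in>{1..n}. x i < \<alpha> + b 0 - c (exceedances \<beta> x i)"
  shows "enat n < fatal_index \<gamma> \<beta> \<alpha> b c x"
proof -
  have "x i < \<alpha> + b (n_plus \<gamma> \<beta> \<alpha> b c x i) - c (n_minus \<gamma> \<beta> \<alpha> b c x i)" if "i \<in> {1..n}" for i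
    using that
  proof (induction i rule: less_induct)
    case (less i)
    then have "n_minus \<gamma> \<beta> \<alpha> b c x i = exceedances \<beta> x i"
      by (intro n_minus_eq_exceedances) auto
    moreover have "b 0 \<le> b (n_plus \<gamma> \<beta> \<alpha> b c x i)"
      using b by (auto simp: incseq_def)
    ultimately show ?case using alive less.prems by force
  qed
  then show ?thesis by (simp add: less_fatal_index_iff)
qed

text \<open>The upper half of the comparison: at most \<open>K\<close> of the first \<open>n\<close>
  shocks reach \<open>\<gamma>\<close>, so \<open>n_plus\<close> never exceeds \<open>K\<close> and
  freezing \<open>b\<close> at \<open>b K\<close> can only raise the thresholds.\<close>

lemma less_fatal_indexD:
  assumes b: "incseq b"
    and alive: "enat n < fatal_index \<gamma> \<beta> \<alpha> b c x"
    and K: "exceedances \<gamma> x (Suc n) \<le> K"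
    and i: "i \<in> {1..n}"
  shows "x i < \<alpha> + b K - c (exceedances \<beta> x i)"
proof -
  have "n_minus \<gamma> \<beta> \<alpha> b c x i = exceedances \<beta> x i"
    using alive i by (intro n_minus_eq_exceedances) (auto simp: less_fatal_index_iff)
  moreover have "n_plus \<gamma> \<beta> \<alpha> b c x i \<le> K"
    using n_plus_le_exceedances[of \<gamma> \<beta> \<alpha> b c x i] exceedances_mono[of i "Suc n" \<gamma> x] K i by simp
  then have "b (n_plus \<gamma> \<beta> \<alpha> b c x i) \<le> b K"
    using b by (auto simp: incseq_def)
  ultimately show ?thesis using alive i by (force simp: less_fatal_index_iff)
qed

context prob_space
begin

lemma prob_eq_if_distr_eq:
  assumes "distr M N U = distr M N V" "U \<in> measurable M N" "V \<in> measurable M N" "B \<in> sets N"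
  shows "prob {\<omega> \<in> space M. U \<omega> \<in> B} = prob {\<omega> \<in> space M. V \<omega> \<in> B}"
  using assms measure_distr[of U M N B] measure_distr[of V M N B]
  by (simp add: vimage_def Int_def conj_commute)

section \<open>Measurability of the counters\<close>

lemma exceedances_measurable:
  assumes [measurable]: "\<And>i. i \<ge> 1 \<Longrightarrow> X i \<in> borel_measurable M"
  shows "(\<lambda>\<omega>. exceedances \<beta> (\<lambda>i. X i \<omega>) n) \<in> measurable M (count_space UNIV)"
proof (induction n)
  case 0
  then show ?case by (simp add: exceedances_def)
next
  case (Suc n)
  note Suc [measurable]
  show ?case
  proof (cases "n = 0")
    case True
    then show ?thesis by simp
  next
    case False
    then have [measurable]: "X n \<in> borel_measurable M" by simp
    have "exceedances \<beta> (\<lambda>i. X i \<omega>) (Suc n) =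
        (if X n \<omega> \<ge> \<beta> then Suc (exceedances \<beta> (\<lambda>i. X i \<omega>) n) else exceedances \<beta> (\<lambda>i. X i \<omega>) n)" for \<omega>
      using False by (simp add: exceedances_Suc)
    then show ?thesis by simp
  qed
qed

text \<open>Proved as a conjunction because the one-step recursion of each counter involves the
  other.\<close>

lemma n_minus_n_plus_measurable:
  assumes X: "\<And>i. i \<ge> 1 \<Longrightarrow> X i \<in> borel_measurable M"
  shows "(\<lambda>\<omega>. n_minus \<gamma> \<beta> \<alpha> b c (\<lambda>i. X i \<omega>) n) \<in> measurable M (count_space UNIV)
    \<and> (\<lambda>\<omega>. n_plus \<gamma> \<beta> \<alpha> b c (\<lambda>i. X i \<omega>) n) \<in> measurable M (count_space UNIV)"
proof (induction n)
  case 0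
  show ?case by (simp add: n_minus_n_plus_initial)
next
  case (Suc n)
  note Suc[THEN conjunct1, measurable] Suc[THEN conjunct2, measurable]
  show ?case
  proof (cases "n = 0")
    case True
    then show ?thesis by (simp add: n_minus_n_plus_initial)
  next
    case False
    then have n: "n \<ge> 1" by simp
    have [measurable]: "X n \<in> borel_measurable M" using X n by simp
    show ?thesis unfolding n_minus_Suc[OF n] n_plus_Suc[OF n] by (intro conjI) measurable
  qed
qed

lemma survival_step_measurable:
  assumes X: "\<And>i. i \<ge> 1 \<Longrightarrow> X i \<in> borel_measurable M" and i: "i \<ge> 1"
  shows "{\<omega> \<in> space M. X i \<omega> < d (exceedances \<beta> (\<lambda>i. X i \<omega>) i)} \<in> events"
proof -
  note exceedances_measurable[OF X, measurable] X[OF i, measurable]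
  show ?thesis by measurable
qed

lemma prob_cylinder:
  assumes indep: "indep_vars (\<lambda>_. borel) X {1..}"
    and ident: "\<And>i. i \<ge> 1 \<Longrightarrow> distr M borel (X i) = distr M borel (X 1)"
    and "\<And>i. i \<in> {Suc n..m} \<Longrightarrow> B i \<in> sets borel"
  shows "prob {\<omega> \<in> space M. \<forall>i\<in>{Suc n..m}. X i \<omega> \<in> B i}
    = (\<Prod>i=Suc n..m. prob {\<omega> \<in> space M. X 1 \<omega> \<in> B i})"
\<comment> \<open>The product rule for independent variables is applied to a nonempty index set; for
  an empty range both sides are 1.\<close>
proof (cases "Suc n \<le> m")
  case True
  have X: "random_variable borel (X i)" if "i \<ge> 1" for i
    using indep that by (auto simp: indep_vars_def)
  have "prob (\<Inter>i\<in>{Suc n..m}. X i -` B i \<inter> space M) = (\<Prod>i\<in>{Suc n..m}. prob (X i -` B i \<inter> space M))"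
    using True assms(3) by (intro indep_varsD[OF indep]) auto
  moreover have "(\<Inter>i\<in>{Suc n..m}. X i -` B i \<inter> space M) = {\<omega> \<in> space M. \<forall>i\<in>{Suc n..m}. X i \<omega> \<in> B i}"
    using True by auto
  moreover have "prob (X i -` B i \<inter> space M) = prob {\<omega> \<in> space M. X 1 \<omega> \<in> B i}" if "i \<in> {Suc n..m}" for i
    using prob_eq_if_distr_eq[OF ident[of i] X X assms(3)[OF that]] that
    by (simp add: vimage_def Int_def conj_commute)
  ultimately show ?thesis by simp
qed (simp add: prob_space)

text \<open>The extra constraint on the shocks after the \<open>n\<close>-th one carries the independence through the
  induction.\<close>

lemma prob_survival_exceedances_cylinder:
  assumes indep: "indep_vars (\<lambda>_. borel) X {1..}"
    and ident: "\<And>i. i \<ge> 1 \<Longrightarrow> distr M borel (X i) = distr M borel (X 1)"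
    and d: "\<And>l. \<beta> \<le> d l"
    and "n \<le> m" and "\<And>i. B i \<in> sets borel"
  shows "prob {\<omega> \<in> space M. (\<forall>i\<in>{1..n}. X i \<omega> < d (exceedances \<beta> (\<lambda>i. X i \<omega>) i))
        \<and> exceedances \<beta> (\<lambda>i. X i \<omega>) (Suc n) = j \<and> (\<forall>i\<in>{Suc n..m}. X i \<omega> \<in> B i)}
    = real (n choose j) * prob {\<omega> \<in> space M. X 1 \<omega> < \<beta>} ^ (n - j)
      * (\<Prod>h<j. prob {\<omega> \<in> space M. X 1 \<omega> \<in> {\<beta>..<d h}})
      * (\<Prod>i=Suc n..m. prob {\<omega> \<in> space M. X 1 \<omega> \<in> B i})"
  using assms(4,5)
proof (induction n arbitrary: j B)
  case 0
  show ?case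
  proof (cases "j = 0")
    case True
    then show ?thesis using prob_cylinder[OF indep ident, of 0 m B] 0 by simp
  next
    case False
    then show ?thesis by simp
  qed
next
  case (Suc n)
  let ?E = "\<lambda>\<omega> i. exceedances \<beta> (\<lambda>i. X i \<omega>) i"
  let ?A = "\<lambda>n j B. {\<omega> \<in> space M. (\<forall>i\<in>{1..n}. X i \<omega> < d (?E \<omega> i))
        \<and> ?E \<omega> (Suc n) = j \<and> (\<forall>i\<in>{Suc n..m}. X i \<omega> \<in> B i)}"
  let ?p = "\<lambda>B. prob {\<omega> \<in> space M. X 1 \<omega> \<in> B}"
  let ?below = "prob {\<omega> \<in> space M. X 1 \<omega> < \<beta>}"
  have X [measurable]: "random_variable borel (X i)" if "i \<ge> 1" for i
    using indep that by (auto simp: indep_vars_def)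
  note Suc.prems(2) [measurable]
  \<comment> \<open>Slot \<open>Suc n\<close> of \<open>B\<close> is overwritten by the set
    \<open>C\<close> prescribed for the next shock, so that the induction hypothesis for
    \<open>n\<close> treats this shock as part of the future.\<close>
  have A_meas: "?A n j (B(Suc n := C)) \<in> events" if [measurable]: "C \<in> sets borel" for j C
  proof -
    have [measurable]: "(B(Suc n := C)) i \<in> sets borel" for i using Suc.prems(2) by simp
    have [measurable]: "(\<lambda>\<omega>. ?E \<omega> i) \<in> measurable M (count_space UNIV)" for i
      by (rule exceedances_measurable) (rule X)
    have [measurable]: "{\<omega> \<in> space M. X i \<omega> < d (?E \<omega> i)} \<in> events" if "i \<in> {1..n}" for i
      using that by (intro survival_step_measurable X) auto
    have [measurable]: "{\<omega> \<in> space M. X i \<omega> \<in> (B(Suc n := C)) i} \<in> events" if "i \<in> {Suc n..m}" for i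
    proof -
      have [measurable]: "X i \<in> borel_measurable M" using that by (intro X) simp
      show ?thesis by measurable
    qed
    show ?thesis by measurable
  qed
  have IH: "prob (?A n j (B(Suc n := C))) = real (n choose j) * ?below ^ (n - j) * (\<Prod>h<j. ?p {\<beta>..<d h})
      * (?p C * (\<Prod>i=Suc (Suc n)..m. ?p (B i)))" if "C \<in> sets borel" for j C
  proof -
    have "(\<Prod>i=Suc n..m. ?p ((B(Suc n := C)) i))
        = ?p ((B(Suc n := C)) (Suc n)) * (\<Prod>i=Suc (Suc n)..m. ?p ((B(Suc n := C)) i))"
      using Suc.prems(1) by (intro prod.atLeast_Suc_atMost) auto
    also have "(\<Prod>i=Suc (Suc n)..m. ?p ((B(Suc n := C)) i)) = (\<Prod>i=Suc (Suc n)..m. ?p (B i))"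
      by (intro prod.cong) auto
    finally show ?thesis
      using Suc.IH[of "B(Suc n := C)" j] Suc.prems that by simp
  qed
  have split_Suc: "(\<forall>i\<in>{1..Suc n}. P i) \<longleftrightarrow> (\<forall>i\<in>{1..n}. P i) \<and> P (Suc n)"
      "(\<forall>i\<in>{Suc n..m}. P i) \<longleftrightarrow> P (Suc n) \<and> (\<forall>i\<in>{Suc (Suc n)..m}. P i)" for P
  proof -
    have "{1..Suc n} = insert (Suc n) {1..n}" by auto
    then show "(\<forall>i\<in>{1..Suc n}. P i) \<longleftrightarrow> (\<forall>i\<in>{1..n}. P i) \<and> P (Suc n)" by auto
    have "{Suc n..m} = insert (Suc n) {Suc (Suc n)..m}" using Suc.prems(1) by auto
    then show "(\<forall>i\<in>{Suc n..m}. P i) \<longleftrightarrow> P (Suc n) \<and> (\<forall>i\<in>{Suc (Suc n)..m}. P i)" by auto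
  qed
  have rest: "(\<forall>i\<in>{Suc (Suc n)..m}. X i \<omega> \<in> (B(Suc n := C)) i) \<longleftrightarrow> (\<forall>i\<in>{Suc (Suc n)..m}. X i \<omega> \<in> B i)" for \<omega> C
    by auto
  have E_Suc: "?E \<omega> (Suc (Suc n)) = ?E \<omega> (Suc n) + of_bool (X (Suc n) \<omega> \<ge> \<beta>)" for \<omega>
    by (rule exceedances_Suc) simp
  show ?case
  proof (cases j)
    case 0
    \<comment> \<open>With no exceedance so far, shock \<open>Suc n\<close> lies below
      \<open>\<beta>\<close> and hence below the threshold \<open>d 0\<close>.\<close>
    have "?A (Suc n) 0 B = ?A n 0 (B(Suc n := {..<\<beta>}))"
      unfolding split_Suc rest E_Suc using d[of 0] by auto
    then show ?thesis using IH[of "{..<\<beta>}" 0] 0 by simp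
  next
    case j: (Suc j')
    \<comment> \<open>Either shock \<open>Suc n\<close> stays below \<open>\<beta>\<close> and the
      count was already \<open>Suc j'\<close>, or it is the exceedance that raises the count from
      \<open>j'\<close> and must then stay below the threshold \<open>d j'\<close>.\<close>
    have "?A (Suc n) (Suc j') B = ?A n (Suc j') (B(Suc n := {..<\<beta>})) \<union> ?A n j' (B(Suc n := {\<beta>..<d j'}))"
      unfolding split_Suc rest E_Suc using d[of "Suc j'"] by (auto simp: not_le)
    moreover have "?A n (Suc j') (B(Suc n := {..<\<beta>})) \<inter> ?A n j' (B(Suc n := {\<beta>..<d j'})) = {}"
      by auto
    ultimately have "prob (?A (Suc n) (Suc j') B)
        = prob (?A n (Suc j') (B(Suc n := {..<\<beta>}))) + prob (?A n j' (B(Suc n := {\<beta>..<d j'})))"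
      using finite_measure_Union[OF A_meas A_meas, of "{..<\<beta>}" "{\<beta>..<d j'}" "Suc j'" j'] by simp
    also have "\<dots> = (real (n choose Suc j') * (?below ^ (n - Suc j') * ?below) * (\<Prod>h<Suc j'. ?p {\<beta>..<d h})
        + real (n choose j') * ?below ^ (n - j') * (\<Prod>h<Suc j'. ?p {\<beta>..<d h})) * (\<Prod>i=Suc (Suc n)..m. ?p (B i))"
      by (subst (1 2) IH) (simp_all add: algebra_simps)
    \<comment> \<open>Truncated subtraction spoils the exponent only if \<open>n < Suc j'\<close>,
      and then the binomial coefficient is zero. Pascal's rule finishes the step afterwards.\<close>
    also have "real (n choose Suc j') * (?below ^ (n - Suc j') * ?below) = real (n choose Suc j') * ?below ^ (n - j')"
    proof (cases "Suc j' \<le> n")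
      case True
      then have "n - j' = Suc (n - Suc j')" by simp
      then show ?thesis by simp
    qed simp
    finally show ?thesis by (simp add: j algebra_simps)
  qed
qed

text \<open>The event is split by the number \<open>j\<close> of exceedances. Counting from 0, the
  \<open>h\<close>-th exceedance always faces the threshold \<open>d h\<close>, wherever it occurs,
  so every choice of the \<open>j\<close> positions contributes the same product and the binomial
  coefficient counts the choices.\<close>

lemma prob_survival:
  assumes indep: "indep_vars (\<lambda>_. borel) X {1..}"
    and ident: "\<And>i. i \<ge> 1 \<Longrightarrow> distr M borel (X i) = distr M borel (X 1)"
    and d: "\<And>l. \<beta> \<le> d l"
  shows "prob {\<omega> \<in> space M. \<forall>i\<in>{1..n}. X i \<omega> < d (exceedances \<beta> (\<lambda>i. X i \<omega>) i)}
    = (\<Sum>j\<le>n. real (n choose j) * (1 - tail M (X 1) \<beta>) ^ (n - j)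
        * (\<Prod>h<j. tail M (X 1) \<beta> - tail M (X 1) (d h)))"
proof -
  let ?E = "\<lambda>\<omega> i. exceedances \<beta> (\<lambda>i. X i \<omega>) i"
  let ?A = "\<lambda>j. {\<omega> \<in> space M. (\<forall>i\<in>{1..n}. X i \<omega> < d (?E \<omega> i)) \<and> ?E \<omega> (Suc n) = j}"
  have X [measurable]: "random_variable borel (X i)" if "i \<ge> 1" for i
    using indep that by (auto simp: indep_vars_def)
  have [measurable]: "(\<lambda>\<omega>. ?E \<omega> i) \<in> measurable M (count_space UNIV)" for i
    by (rule exceedances_measurable) (rule X)
  have [measurable]: "{\<omega> \<in> space M. X i \<omega> < d (?E \<omega> i)} \<in> events" if "i \<in> {1..n}" for i
    using that by (intro survival_step_measurable X) auto
  have "{\<omega> \<in> space M. \<forall>i\<in>{1..n}. X i \<omega> < d (?E \<omega> i)} = (\<Union>j\<in>{..n}. ?A j)"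
    using exceedances_Suc_le by auto
  also have "prob \<dots> = (\<Sum>j\<le>n. prob (?A j))"
    by (rule finite_measure_finite_Union) (auto simp: disjoint_family_on_def)
  also have "\<dots> = (\<Sum>j\<le>n. real (n choose j) * (1 - tail M (X 1) \<beta>) ^ (n - j)
        * (\<Prod>h<j. tail M (X 1) \<beta> - tail M (X 1) (d h)))"
  proof (rule sum.cong)
    fix j
    have "prob {\<omega> \<in> space M. X 1 \<omega> \<in> {\<beta>..<d h}} = tail M (X 1) \<beta> - tail M (X 1) (d h)" for h
    proof -
      have "{\<omega> \<in> space M. X 1 \<omega> \<in> {\<beta>..<d h}} = {\<omega> \<in> space M. X 1 \<omega> < d h} - {\<omega> \<in> space M. X 1 \<omega> < \<beta>}"
        by auto
      also have "prob \<dots> = prob {\<omega> \<in> space M. X 1 \<omega> < d h} - prob {\<omega> \<in> space M. X 1 \<omega> < \<beta>}"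
        using d[of h] X[of 1] by (intro finite_measure_Diff) auto
      finally show ?thesis by (simp add: tail_def left_cdf_def)
    qed
    then show "prob (?A j) = real (n choose j) * (1 - tail M (X 1) \<beta>) ^ (n - j)
        * (\<Prod>h<j. tail M (X 1) \<beta> - tail M (X 1) (d h))"
      \<comment> \<open>With \<open>m = n\<close> no later shock is left, and the cylinder factor is
        an empty product.\<close>
      using prob_survival_exceedances_cylinder[OF indep ident d, where n=n and m=n and j=j and B="\<lambda>_. UNIV"]
      by (simp add: tail_def left_cdf_def)
  qed simp
  finally show ?thesis .
qed

text \<open>Markov's inequality for the number of shocks that reach \<open>\<gamma>\<close>; more
  than \<open>K\<close> of them means at least \<open>Suc K\<close>.\<close>

lemma prob_exceedances_gt:
  assumes indep: "indep_vars (\<lambda>_. borel) X {1..}"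
    and ident: "\<And>i. i \<ge> 1 \<Longrightarrow> distr M borel (X i) = distr M borel (X 1)"
  shows "prob {\<omega> \<in> space M. exceedances \<gamma> (\<lambda>i. X i \<omega>) (Suc n) > K} \<le> n * tail M (X 1) \<gamma> / Suc K"
proof -
  have X: "random_variable borel (X i)" if "i \<ge> 1" for i
    using indep that by (auto simp: indep_vars_def)
  let ?ind = "\<lambda>i \<omega>. indicator {\<omega> \<in> space M. X i \<omega> \<ge> \<gamma>} \<omega> :: real"
  have meas: "{\<omega> \<in> space M. X i \<omega> \<ge> \<gamma>} \<in> events" if "i \<ge> 1" for i
    using X[OF that] by measurable
  have E: "real (exceedances \<gamma> (\<lambda>i. X i \<omega>) (Suc n)) = (\<Sum>i=1..n. ?ind i \<omega>)" if "\<omega> \<in> space M" for \<omega>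
    unfolding exceedances_def atLeastLessThanSuc_atLeastAtMost using that
    by (simp add: indicator_def of_bool_def if_distrib cong: if_cong)
  have "{\<omega> \<in> space M. exceedances \<gamma> (\<lambda>i. X i \<omega>) (Suc n) > K} = {\<omega> \<in> space M. (\<Sum>i=1..n. ?ind i \<omega>) \<ge> real (Suc K)}"
  proof (intro Collect_cong conj_cong refl)
    fix \<omega> assume "\<omega> \<in> space M"
    then show "exceedances \<gamma> (\<lambda>i. X i \<omega>) (Suc n) > K \<longleftrightarrow> (\<Sum>i=1..n. ?ind i \<omega>) \<ge> real (Suc K)"
      by (simp only: E[symmetric] of_nat_le_iff Suc_le_eq)
  qed
  also have "prob \<dots> \<le> expectation (\<lambda>\<omega>. \<Sum>i=1..n. ?ind i \<omega>) / Suc K"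
    using meas by (intro integral_Markov_inequality_measure[where A="{}"])
      (auto intro!: sum_nonneg integrable_real_indicator simp: emeasure_eq_measure)
  also have "expectation (\<lambda>\<omega>. \<Sum>i=1..n. ?ind i \<omega>) = (\<Sum>i=1..n. tail M (X 1) \<gamma>)"
  proof (subst Bochner_Integration.integral_sum)
    show "(\<Sum>i=1..n. expectation (?ind i)) = (\<Sum>i=1..n. tail M (X 1) \<gamma>)"
    proof (rule sum.cong)
      fix i assume "i \<in> {1..n}"
      then have i: "i \<ge> 1" by simp
      have "expectation (?ind i) = prob {\<omega> \<in> space M. X i \<omega> \<in> {\<gamma>..}}"
        using meas[OF i] by simp
      also have "\<dots> = prob {\<omega> \<in> space M. X 1 \<omega> \<in> {\<gamma>..}}"
        by (rule prob_eq_if_distr_eq[OF ident[OF i]]) (use X i in auto)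
      also have "\<dots> = tail M (X 1) \<gamma>"
        using tail_eq_prob_ge[OF X[of 1]] by simp
      finally show "expectation (?ind i) = tail M (X 1) \<gamma>" .
    qed simp
  qed (use meas in \<open>auto intro!: integrable_real_indicator simp: emeasure_eq_measure\<close>)
  finally show ?thesis by simp
qed

end

section \<open>The fatal index and the failure time\<close>

text \<open>A natural number exceeds \<open>r\<close> exactly when it exceeds the integer part of
  \<open>r\<close>, so the real time scale can be replaced by a number of shocks.\<close>

lemma less_ereal_of_enat_iff:
  assumes "r \<ge> 0"
  shows "ereal_of_enat \<nu> > ereal r \<longleftrightarrow> enat (nat \<lfloor>r\<rfloor>) < \<nu>"
proof (cases \<nu>)
  case (enat m)
  have "r < real m \<longleftrightarrow> nat \<lfloor>r\<rfloor> < m"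
    using assms by linarith
  then show ?thesis by (simp add: enat)
qed simp

lemma shock_time_mono:
  assumes "\<And>i. i \<ge> 1 \<Longrightarrow> y i \<ge> 0" and "m \<le> n"
  shows "shock_time y m \<le> shock_time y n"
proof (cases n)
  case (enat n')
  with assms(2) obtain m' where "m = enat m'" "m' \<le> n'"
    by (cases m) auto
  with assms(1) enat show ?thesis by (auto intro!: sum_mono2)
qed simp

context prob_space
begin

section \<open>The tail at the upper endpoint, and measurability of the events\<close>

lemma left_cdf_mono:
  assumes [measurable]: "random_variable borel X" and "x \<le> y"
  shows "left_cdf M X x \<le> left_cdf M X y"
  unfolding left_cdf_def using assms(2) by (intro finite_measure_mono) auto

text \<open>For an infinite endpoint this is the limit of a distribution function at infinity. For a
  finite endpoint, continuity there gives the value 1. The endpoint cannot be minus infinity,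
  because \<open>y\<close> lies below it.\<close>

lemma left_cdf_tendsto_1:
  assumes X [measurable]: "random_variable borel X"
    and not_top: "left_cdf M X y < 1"
    and cont: "\<And>x. ereal x = upper_endpoint M X \<Longrightarrow> isCont (left_cdf M X) x"
    and lim: "((\<lambda>t. ereal (\<beta> t)) \<longlongrightarrow> upper_endpoint M X) F"
  shows "((\<lambda>t. left_cdf M X (\<beta> t)) \<longlongrightarrow> 1) F"
proof (cases "upper_endpoint M X")
  case PInf
  interpret D: prob_space "distr M borel X" by (rule prob_space_distr) simp
  interpret D: real_distribution "distr M borel X" by unfold_locales auto
  show ?thesis
  proof (rule order_tendstoI)
    fix l :: real assume "l < 1"
    then have "eventually (\<lambda>x. cdf (distr M borel X) x > l) at_top"
      by (rule order_tendstoD[OF D.cdf_lim_at_top_prob])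
    then obtain x where x: "cdf (distr M borel X) x > l"
      using eventually_happens'[OF trivial_limit_at_top_linorder] by blast
    have "cdf (distr M borel X) x = prob {\<omega> \<in> space M. X \<omega> \<le> x}"
      by (simp add: cdf_def measure_distr vimage_def Int_def conj_commute)
    moreover have "eventually (\<lambda>t. ereal x < ereal (\<beta> t)) F"
      using lim PInf by (intro order_tendstoD(1)) auto
    then have "eventually (\<lambda>t. prob {\<omega> \<in> space M. X \<omega> \<le> x} \<le> left_cdf M X (\<beta> t)) F"
      unfolding left_cdf_def by eventually_elim (auto intro!: finite_measure_mono)
    ultimately show "eventually (\<lambda>t. l < left_cdf M X (\<beta> t)) F"
      using x by (auto elim: eventually_mono)
  next
    fix u :: real assume "1 < u"
    then show "eventually (\<lambda>t. left_cdf M X (\<beta> t) < u) F"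
      by (intro always_eventually allI) (auto simp: left_cdf_def intro: le_less_trans[OF prob_le_1])
  qed
next
  case (real r)
  have "left_cdf M X x = 1" if "x > r" for x
  proof (rule ccontr)
    assume "left_cdf M X x \<noteq> 1"
    then have "left_cdf M X x < 1"
      using prob_le_1 by (simp add: left_cdf_def less_le)
    then have "ereal x \<le> upper_endpoint M X"
      unfolding upper_endpoint_def by (intro Sup_upper) auto
    then show False using real that by simp
  qed
  then have "eventually (\<lambda>x. left_cdf M X x = 1) (at_right r)"
    by (auto simp: eventually_at_filter)
  then have "(left_cdf M X \<longlongrightarrow> 1) (at_right r)"
    by (rule tendsto_eventually)
  \<comment> \<open>An atom at \<open>r\<close> would leave the left-continuous function below 1
    there; continuity forces its value to equal the limit 1 from the right.\<close>
  moreover have cont_r: "isCont (left_cdf M X) r"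
    using cont[of r] real by simp
  then have "(left_cdf M X \<longlongrightarrow> left_cdf M X r) (at_right r)"
    by (simp add: isCont_def filterlim_at_split)
  ultimately have "left_cdf M X r = 1"
    using tendsto_unique[OF trivial_limit_at_right_real] by blast
  moreover have "(\<beta> \<longlongrightarrow> r) F" using lim real by simp
  ultimately show ?thesis
    using isCont_tendsto_compose[OF cont_r] by fastforce
next
  case MInf
  have "ereal y \<le> upper_endpoint M X"
    unfolding upper_endpoint_def using not_top by (intro Sup_upper) auto
  then show ?thesis using MInf by simp
qed

lemma less_fatal_index_measurable:
  assumes X: "\<And>i. i \<ge> 1 \<Longrightarrow> random_variable borel (X i)"
  shows "{\<omega> \<in> space M. enat n < fatal_index \<gamma> \<beta> \<alpha> b c (\<lambda>i. X i \<omega>)} \<in> events"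
proof -
  note n_minus_n_plus_measurable[OF X, THEN conjunct1, measurable]
  note n_minus_n_plus_measurable[OF X, THEN conjunct2, measurable]
  have [measurable]: "{\<omega> \<in> space M. X i \<omega> < \<alpha> + b (n_plus \<gamma> \<beta> \<alpha> b c (\<lambda>i. X i \<omega>) i)
      - c (n_minus \<gamma> \<beta> \<alpha> b c (\<lambda>i. X i \<omega>) i)} \<in> events" if "i \<in> {1..n}" for i
  proof -
    have [measurable]: "random_variable borel (X i)" using that by (intro X) simp
    show ?thesis by measurable
  qed
  show ?thesis unfolding less_fatal_index_iff by measurable
qed

lemma shock_time_fatal_index_measurable:
  assumes X: "\<And>i. i \<ge> 1 \<Longrightarrow> random_variable borel (X i)"
    and Y: "\<And>i. i \<ge> 1 \<Longrightarrow> random_variable borel (Y i)"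
  shows "{\<omega> \<in> space M. shock_time (\<lambda>i. Y i \<omega>) (fatal_index \<gamma> \<beta> \<alpha> b c (\<lambda>i. X i \<omega>)) > ereal r} \<in> events"
proof -
  let ?\<nu> = "\<lambda>\<omega>. fatal_index \<gamma> \<beta> \<alpha> b c (\<lambda>i. X i \<omega>)"
  \<comment> \<open>Writes the event through countably many events of the form
    \<open>enat m < \<nu>\<close>: an \<open>m\<close> that is not below \<open>\<nu>\<close> while
    all smaller numbers are is \<open>\<nu>\<close> itself.\<close>
  have iff: "shock_time y \<nu> > ereal r \<longleftrightarrow>
      (\<forall>m. enat m < \<nu>) \<or> (\<exists>m. \<not> enat m < \<nu> \<and> (\<forall>k<m. enat k < \<nu>) \<and> (\<Sum>i=1..m. y i) > r)" for y \<nu>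
  proof (cases \<nu>)
    case (enat n)
    have "m = n" if "\<not> m < n" "\<forall>k<m. k < n" for m
      using that by (metis linorder_neqE_nat less_irrefl)
    then have "(\<exists>m. \<not> m < n \<and> (\<forall>k<m. k < n) \<and> (\<Sum>i=1..m. y i) > r) \<longleftrightarrow> (\<Sum>i=1..n. y i) > r"
      by (metis less_irrefl)
    then show ?thesis using enat by auto
  qed simp
  note less_fatal_index_measurable[OF X, measurable]
  have [measurable]: "random_variable borel (Y i)" if "i \<in> {1..m}" for i m
    using that by (intro Y) simp
  show ?thesis unfolding iff by measurable
qed

section \<open>Limit law of the fatal index\<close>

text \<open>Survival of the true model (\<open>P\<close>) is squeezed between survival of frozen
  models (\<open>S\<close>), with an excess \<open>Q\<close> of strengthening candidates added
  above. All frozen models share one limit because \<open>a h\<close> does not depend on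
  \<open>k\<close>.\<close>

lemma prob_fatal_index_tendsto:
  fixes \<alpha> \<beta> \<gamma> :: "real \<Rightarrow> real" and b c :: "real \<Rightarrow> nat \<Rightarrow> real"
  assumes indep: "indep_vars (\<lambda>_. borel) X {1..}"
    and ident: "\<And>i. i \<ge> 1 \<Longrightarrow> distr M borel (X i) = distr M borel (X 1)"
    and tail_pos: "\<And>t. tail M (X 1) (\<beta> t) > 0"
    and tail_lim: "((\<lambda>t. tail M (X 1) (\<beta> t)) \<longlongrightarrow> 0) F"
    and F: "F \<noteq> bot"
    and b: "\<And>t. incseq (b t)"
    and above_\<beta>: "\<And>t k l. \<alpha> t + b t k - c t l \<ge> \<beta> t"
    and g: "g > 0" "((\<lambda>t. tail M (X 1) (\<beta> t) / tail M (X 1) (\<gamma> t)) \<longlongrightarrow> g) F"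
    and a_lim: "\<And>k h. ((\<lambda>t. tail M (X 1) (\<alpha> t + b t k - c t h) / tail M (X 1) (\<beta> t)) \<longlongrightarrow> a h) F"
    and z: "z > 0"
  shows "((\<lambda>t. prob {\<omega> \<in> space M. enat (nat \<lfloor>z / tail M (X 1) (\<beta> t)\<rfloor>)
      < fatal_index (\<gamma> t) (\<beta> t) (\<alpha> t) (b t) (c t) (\<lambda>i. X i \<omega>)}) \<longlongrightarrow> 1 - limit_df a z) F"
proof -
  have X: "random_variable borel (X i)" if "i \<ge> 1" for i
    using indep that by (auto simp: indep_vars_def)
  define p where "p = (\<lambda>t. tail M (X 1) (\<beta> t))"
  define n where "n = (\<lambda>t. nat \<lfloor>z / p t\<rfloor>)"
  define S where "S = (\<lambda>k t. {\<omega> \<in> space M. \<forall>i\<in>{1..n t}.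
      X i \<omega> < \<alpha> t + b t k - c t (exceedances (\<beta> t) (\<lambda>i. X i \<omega>) i)})"
  define P where "P = (\<lambda>t. {\<omega> \<in> space M. enat (n t) <
      fatal_index (\<gamma> t) (\<beta> t) (\<alpha> t) (b t) (c t) (\<lambda>i. X i \<omega>)})"
  define Q where "Q = (\<lambda>K t. {\<omega> \<in> space M. exceedances (\<gamma> t) (\<lambda>i. X i \<omega>) (Suc (n t)) > K})"
  have p_pos: "p t > 0" for t using tail_pos by (simp add: p_def)
  have tail_nonneg: "0 \<le> tail M (X 1) x" and tail_le_1: "tail M (X 1) x \<le> 1" for x
    by (auto simp: tail_def left_cdf_def)
  have p0: "(p \<longlongrightarrow> 0) F" using tail_lim by (simp add: p_def)
  have S_lim: "((\<lambda>t. prob (S k t)) \<longlongrightarrow> 1 - limit_df a z) F" for k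
  proof -
    have "((\<lambda>t. \<Sum>j\<le>n t. (n t choose j) * (1 - p t) ^ (n t - j)
        * (\<Prod>h<j. p t - tail M (X 1) (\<alpha> t + b t k - c t h))) \<longlongrightarrow> 1 - limit_df a z) F"
    proof (rule binomial_thinned_tendsto[OF F p0 p_pos _ _ z])
      show "((\<lambda>t. n t * p t) \<longlongrightarrow> z) F"
        unfolding n_def using p0 p_pos z by (rule floor_scaled_tendsto)
      show "tail M (X 1) (\<alpha> t + b t k - c t h) \<le> p t" for t h
        using left_cdf_mono[OF X above_\<beta>, of 1] by (simp add: p_def tail_def)
      show "((\<lambda>t. tail M (X 1) (\<alpha> t + b t k - c t h) / p t) \<longlongrightarrow> a h) F" for h
        unfolding p_def by (rule a_lim)
    qed (simp_all only: p_def tail_nonneg tail_le_1)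
    moreover have "prob (S k t) = (\<Sum>j\<le>n t. (n t choose j) * (1 - p t) ^ (n t - j)
        * (\<Prod>h<j. p t - tail M (X 1) (\<alpha> t + b t k - c t h)))" for t
      unfolding S_def p_def
      by (rule prob_survival[OF indep ident, where d="\<lambda>l. \<alpha> t + b t k - c t l"]) (simp_all add: above_\<beta>)
    ultimately show ?thesis by simp
  qed
  have P_meas: "P t \<in> events" for t
    unfolding P_def by (rule less_fatal_index_measurable[OF X])
  have S_meas: "S k t \<in> events" for k t
  proof -
    have [measurable]: "{\<omega> \<in> space M. X i \<omega> < \<alpha> t + b t k - c t (exceedances (\<beta> t) (\<lambda>i. X i \<omega>) i)} \<in> events"
      if "i \<in> {1..n t}" for i
      using that by (intro survival_step_measurable[OF X, where d="\<lambda>l. \<alpha> t + b t k - c t l"]) auto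
    show ?thesis unfolding S_def by measurable
  qed
  have Q_meas: "Q K t \<in> events" for K t
  proof -
    note exceedances_measurable[OF X, measurable]
    show ?thesis unfolding Q_def by measurable
  qed
  have lower: "prob (S 0 t) \<le> prob (P t)" for t
    using P_meas by (intro finite_measure_mono) (auto simp: S_def P_def intro!: less_fatal_indexI[OF b])
  \<comment> \<open>The error term is written with the ratio of the two tails, whose limit is
    \<open>g\<close>.\<close>
  have upper: "prob (P t) \<le> prob (S K t) + z / (p t / tail M (X 1) (\<gamma> t)) / Suc K" for K t
  proof -
    have "P t \<subseteq> S K t \<union> Q K t"
    proof
      fix \<omega> assume \<omega>: "\<omega> \<in> P t"
      then have "\<omega> \<in> S K t" if "\<omega> \<notin> Q K t"
        using that less_fatal_indexD[OF b[of t], where x="\<lambda>i. X i \<omega>" and n="n t" and K=K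
            and \<alpha>="\<alpha> t" and \<beta>="\<beta> t" and \<gamma>="\<gamma> t" and c="c t"]
        by (simp add: P_def S_def Q_def not_less)
      then show "\<omega> \<in> S K t \<union> Q K t" by blast
    qed
    then have "prob (P t) \<le> prob (S K t \<union> Q K t)"
      using S_meas Q_meas by (intro finite_measure_mono) auto
    also have "\<dots> \<le> prob (S K t) + prob (Q K t)"
      using S_meas Q_meas by (rule measure_Un_le)
    also have "prob (Q K t) \<le> n t * tail M (X 1) (\<gamma> t) / Suc K"
      unfolding Q_def by (rule prob_exceedances_gt[OF indep ident])
    also have "\<dots> \<le> z / p t * tail M (X 1) (\<gamma> t) / Suc K"
      using z p_pos[of t] tail_nonneg unfolding n_def
      by (intro divide_right_mono mult_right_mono of_nat_floor) auto
    finally show ?thesis by simp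
  qed
  have "((\<lambda>t. prob (P t)) \<longlongrightarrow> 1 - limit_df a z) F"
  proof (rule order_tendstoI)
    fix l assume "l < 1 - limit_df a z"
    with S_lim[of 0] have "eventually (\<lambda>t. l < prob (S 0 t)) F"
      by (rule order_tendstoD)
    then show "eventually (\<lambda>t. l < prob (P t)) F"
      by eventually_elim (use lower in \<open>auto intro: less_le_trans\<close>)
  next
    fix u assume u: "1 - limit_df a z < u"
    \<comment> \<open>\<open>K\<close> is chosen before the limit in \<open>t\<close> is taken: the
      limiting error \<open>z / g / Suc K\<close> has to fit into the gap below
      \<open>u\<close>.\<close>
    have "(\<lambda>K. (1 - limit_df a z) + z / g / Suc K) \<longlonglongrightarrow> (1 - limit_df a z) + 0"
      by (intro tendsto_intros LIMSEQ_Suc[OF lim_const_over_n])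
    then have "eventually (\<lambda>K. (1 - limit_df a z) + z / g / Suc K < u) sequentially"
      using u by (intro order_tendstoD(2)) auto
    then obtain K where K: "(1 - limit_df a z) + z / g / Suc K < u"
      using eventually_happens'[OF sequentially_bot] by blast
    have "((\<lambda>t. prob (S K t) + z / (p t / tail M (X 1) (\<gamma> t)) / Suc K)
        \<longlongrightarrow> (1 - limit_df a z) + z / g / Suc K) F"
      using g unfolding p_def by (intro tendsto_intros S_lim) auto
    then have "eventually (\<lambda>t. prob (S K t) + z / (p t / tail M (X 1) (\<gamma> t)) / Suc K < u) F"
      using K by (rule order_tendstoD)
    then show "eventually (\<lambda>t. prob (P t) < u) F"
      by eventually_elim (use upper in \<open>auto intro: le_less_trans\<close>)
  qed
  then show ?thesis by (simp add: P_def n_def p_def)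
qed

section \<open>From the fatal index to the failure time\<close>

text \<open>For \<open>s\<close> near \<open>z / \<mu>\<close>, the sum of the first
  \<open>n s t\<close> interarrival times is close to \<open>s * \<mu> / p t\<close> outside the
  event \<open>D\<close>. Monotonicity of the sums then compares \<open>T\<close> with
  \<open>N\<close> for some \<open>s\<close> on either side of \<open>z / \<mu>\<close>, and
  continuity of \<open>G\<close> closes the gap. The law of large numbers is applied only at the
  deterministic indices \<open>n s t\<close>, so dependence between \<open>\<nu>\<close> and
  \<open>Y\<close> does no harm.\<close>

lemma prob_shock_time_tendsto:
  fixes p :: "'b \<Rightarrow> real" and \<nu> :: "'b \<Rightarrow> 'a \<Rightarrow> enat"
  assumes indep: "indep_vars (\<lambda>_. borel) Y {1..}"
    and ident: "\<And>i. i \<ge> 1 \<Longrightarrow> distr M borel (Y i) = distr M borel (Y 1)"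
    and nonneg: "\<And>i. i \<ge> 1 \<Longrightarrow> AE \<omega> in M. Y i \<omega> \<ge> 0"
    and int: "integrable M (Y 1)"
    and \<mu>: "\<mu> = expectation (Y 1)" "\<mu> > 0"
    and p0: "(p \<longlongrightarrow> 0) F" and p_pos: "\<And>t. p t > 0"
    and \<nu>_meas: "\<And>t n. {\<omega> \<in> space M. enat n < \<nu> t \<omega>} \<in> events"
    and T_meas: "\<And>t r. {\<omega> \<in> space M. shock_time (\<lambda>i. Y i \<omega>) (\<nu> t \<omega>) > ereal r} \<in> events"
    and G_cont: "isCont G (z / \<mu>)"
    and G_lim: "\<And>s. s > 0 \<Longrightarrow>
      ((\<lambda>t. prob {\<omega> \<in> space M. enat (nat \<lfloor>s / p t\<rfloor>) < \<nu> t \<omega>}) \<longlongrightarrow> G s) F"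
    and z: "z > 0"
  shows "((\<lambda>t. prob {\<omega> \<in> space M. shock_time (\<lambda>i. Y i \<omega>) (\<nu> t \<omega>) > ereal (z / p t)})
    \<longlongrightarrow> G (z / \<mu>)) F"
proof -
  define n where "n = (\<lambda>s t. nat \<lfloor>s / p t\<rfloor>)"
  define T where "T = (\<lambda>t. {\<omega> \<in> space M. shock_time (\<lambda>i. Y i \<omega>) (\<nu> t \<omega>) > ereal (z / p t)})"
  define N where "N = (\<lambda>s t. {\<omega> \<in> space M. enat (n s t) < \<nu> t \<omega>})"
  define D where "D = (\<lambda>\<epsilon> m. {\<omega> \<in> space M. \<bar>(\<Sum>i=1..m. Y i \<omega>) / real m - \<mu>\<bar> \<ge> \<epsilon>})"
  have Y: "random_variable borel (Y i)" if "i \<ge> 1" for i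
    using indep that by (auto simp: indep_vars_def)
  have D_meas [measurable]: "D \<epsilon> m \<in> events" for \<epsilon> m
  proof -
    have [measurable]: "random_variable borel (Y i)" if "i \<in> {1..m}" for i
      using that by (intro Y) simp
    show ?thesis unfolding D_def by measurable
  qed
  have [measurable]: "N s t \<in> events" "T t \<in> events" for s t
    using \<nu>_meas T_meas by (auto simp: N_def T_def)
  have nonneg_all: "AE \<omega> in M. \<forall>i\<ge>1. Y i \<omega> \<ge> 0"
    using nonneg by (subst AE_all_countable) auto
  have np: "((\<lambda>t. n s t * p t) \<longlongrightarrow> s) F" if "s > 0" for s
    unfolding n_def using p0 p_pos that by (rule floor_scaled_tendsto)
  have n_lim: "filterlim (n s) at_top F" if "s > 0" for s
    using p0 p_pos np[OF that] that by (rule filterlim_at_top_if_scaled_tendsto)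
  have n_pos: "eventually (\<lambda>t. n s t > 0) F" if "s > 0" for s
    using n_lim[OF that, unfolded filterlim_at_top, rule_format, of 1] by (simp add: Suc_le_eq)
  have D_lim: "((\<lambda>t. prob (D \<epsilon> (n s t))) \<longlongrightarrow> 0) F" if "s > 0" "\<epsilon> > 0" for s \<epsilon>
    using filterlim_compose[OF weak_law_of_large_numbers[OF indep ident int that(2)] n_lim[OF that(1)]]
    by (simp add: D_def \<mu>(1))
  have G_lim': "((\<lambda>t. prob (N s t)) \<longlongrightarrow> G s) F" if "s > 0" for s
    using G_lim[OF that] by (simp add: N_def n_def)
  have "((\<lambda>t. prob (T t)) \<longlongrightarrow> G (z / \<mu>)) F"
  proof (rule order_tendstoI)
    fix l assume "l < G (z / \<mu>)"
    moreover have "(G \<longlongrightarrow> G (z / \<mu>)) (at_right (z / \<mu>))"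
      using G_cont by (simp add: isCont_def filterlim_at_split)
    ultimately have "eventually (\<lambda>s. l < G s) (at_right (z / \<mu>))"
      by (intro order_tendstoD(1))
    then have "eventually (\<lambda>s. z / \<mu> < s \<and> l < G s) (at_right (z / \<mu>))"
      by (intro eventually_conj eventually_at_right_less)
    then obtain s where s: "z / \<mu> < s" "l < G s"
      using eventually_happens'[OF trivial_limit_at_right_real] by blast
    have "0 < z / \<mu>" using z \<mu> by simp
    with s have s_pos: "s > 0" by linarith
    \<comment> \<open>Half of the available gap: \<open>s * (\<mu> - \<epsilon>)\<close> is the
      midpoint of \<open>z\<close> and \<open>s * \<mu>\<close>. The strict margin absorbs the
      rounding in \<open>n s t\<close>, whose product with \<open>p t\<close> only tends to
      \<open>s\<close>.\<close>
    define \<epsilon> where "\<epsilon> = (\<mu> - z / s) / 2"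
    have zs: "z < s * \<mu>" using s \<mu> by (simp add: field_simps)
    then have \<epsilon>: "\<epsilon> > 0" using s_pos by (simp add: \<epsilon>_def field_simps)
    have "z < s * (\<mu> - \<epsilon>)" using s_pos zs by (simp add: \<epsilon>_def field_simps)
    moreover have "((\<lambda>t. n s t * p t * (\<mu> - \<epsilon>)) \<longlongrightarrow> s * (\<mu> - \<epsilon>)) F"
      by (intro tendsto_intros np s_pos)
    ultimately have "eventually (\<lambda>t. z < n s t * p t * (\<mu> - \<epsilon>)) F"
      by (intro order_tendstoD(1))
    then have le: "eventually (\<lambda>t. prob (N s t) \<le> prob (T t) + prob (D \<epsilon> (n s t))) F"
      using n_pos[OF s_pos]
    proof eventually_elim
      case (elim t)
      have "prob (N s t) \<le> prob (T t \<union> D \<epsilon> (n s t))"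
      proof (rule finite_measure_mono_AE)
        show "AE \<omega> in M. \<omega> \<in> N s t \<longrightarrow> \<omega> \<in> T t \<union> D \<epsilon> (n s t)"
          using nonneg_all
        proof eventually_elim
          case Y_nonneg: (elim \<omega>)
          show ?case
          proof (intro impI, rule ccontr)
            assume \<omega>: "\<omega> \<in> N s t" "\<omega> \<notin> T t \<union> D \<epsilon> (n s t)"
            have "shock_time (\<lambda>i. Y i \<omega>) (enat (n s t)) \<le> shock_time (\<lambda>i. Y i \<omega>) (\<nu> t \<omega>)"
              using Y_nonneg \<omega>(1) by (intro shock_time_mono) (auto simp: N_def)
            also have "\<dots> \<le> ereal (z / p t)"
              using \<omega> by (auto simp: T_def N_def not_less)
            finally have "(\<Sum>i=1..n s t. Y i \<omega>) \<le> z / p t" by simp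
            also have "\<dots> < n s t * (\<mu> - \<epsilon>)"
              using elim p_pos[of t] by (simp add: field_simps)
            finally have "(\<Sum>i=1..n s t. Y i \<omega>) / n s t < \<mu> - \<epsilon>"
              using elim by (simp add: field_simps)
            then have "\<omega> \<in> D \<epsilon> (n s t)"
              using \<omega>(1) by (auto simp: D_def N_def)
            then show False using \<omega>(2) by simp
          qed
        qed
      qed measurable
      also have "\<dots> \<le> prob (T t) + prob (D \<epsilon> (n s t))"
        by (rule measure_Un_le) measurable
      finally show ?case .
    qed
    have "((\<lambda>t. prob (N s t) - prob (D \<epsilon> (n s t))) \<longlongrightarrow> G s - 0) F"
      by (intro tendsto_diff G_lim' D_lim s_pos \<epsilon>)
    then have "eventually (\<lambda>t. l < prob (N s t) - prob (D \<epsilon> (n s t))) F"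
      using s by (intro order_tendstoD(1)) auto
    with le show "eventually (\<lambda>t. l < prob (T t)) F"
      by eventually_elim linarith
  next
    fix u assume "G (z / \<mu>) < u"
    moreover have "(G \<longlongrightarrow> G (z / \<mu>)) (at_left (z / \<mu>))"
      using G_cont by (simp add: isCont_def filterlim_at_split)
    ultimately have "eventually (\<lambda>s. G s < u) (at_left (z / \<mu>))"
      by (intro order_tendstoD(2))
    moreover have "eventually (\<lambda>s. s \<in> {0<..<z / \<mu>}) (at_left (z / \<mu>))"
      using z \<mu> by (intro eventually_at_left_real) simp
    ultimately have "eventually (\<lambda>s. 0 < s \<and> s < z / \<mu> \<and> G s < u) (at_left (z / \<mu>))"
      by eventually_elim simp
    then obtain s where s: "0 < s" "s < z / \<mu>" "G s < u"
      using eventually_happens'[OF trivial_limit_at_left_real] by blast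
    \<comment> \<open>Here the full gap can be used: rounding down makes \<open>n s t\<close> at
      most \<open>s / p t\<close>, which already goes in the right direction.\<close>
    define \<epsilon> where "\<epsilon> = z / s - \<mu>"
    have \<epsilon>: "\<epsilon> > 0" using s \<mu> by (simp add: \<epsilon>_def field_simps)
    have z_eq: "z = s * (\<mu> + \<epsilon>)" using s by (simp add: \<epsilon>_def)
    have le: "eventually (\<lambda>t. prob (T t) \<le> prob (N s t) + prob (D \<epsilon> (n s t))) F"
      using n_pos[OF s(1)]
    proof eventually_elim
      case (elim t)
      have "prob (T t) \<le> prob (N s t \<union> D \<epsilon> (n s t))"
      proof (rule finite_measure_mono_AE)
        show "AE \<omega> in M. \<omega> \<in> T t \<longrightarrow> \<omega> \<in> N s t \<union> D \<epsilon> (n s t)"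
          using nonneg_all
        proof eventually_elim
          case Y_nonneg: (elim \<omega>)
          show ?case
          proof (intro impI, rule ccontr)
            assume \<omega>: "\<omega> \<in> T t" "\<omega> \<notin> N s t \<union> D \<epsilon> (n s t)"
            have "real (n s t) * (\<mu> + \<epsilon>) \<le> s / p t * (\<mu> + \<epsilon>)"
              using \<epsilon> \<mu> s(1) p_pos[of t] unfolding n_def by (intro mult_right_mono of_nat_floor) auto
            also have "\<dots> = z / p t" using z_eq by simp
            finally have "ereal (real (n s t) * (\<mu> + \<epsilon>)) \<le> ereal (z / p t)" by simp
            also have "\<dots> < shock_time (\<lambda>i. Y i \<omega>) (\<nu> t \<omega>)"
              using \<omega>(1) by (simp add: T_def)
            also have "\<dots> \<le> shock_time (\<lambda>i. Y i \<omega>) (enat (n s t))"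
              using Y_nonneg \<omega> by (intro shock_time_mono) (auto simp: N_def T_def not_less)
            finally have "real (n s t) * (\<mu> + \<epsilon>) < (\<Sum>i=1..n s t. Y i \<omega>)" by simp
            then have "\<mu> + \<epsilon> < (\<Sum>i=1..n s t. Y i \<omega>) / n s t"
              using elim by (simp add: field_simps)
            then have "\<omega> \<in> D \<epsilon> (n s t)"
              using \<omega>(1) by (auto simp: D_def T_def)
            then show False using \<omega>(2) by simp
          qed
        qed
      qed measurable
      also have "\<dots> \<le> prob (N s t) + prob (D \<epsilon> (n s t))"
        by (rule measure_Un_le) measurable
      finally show ?case .
    qed
    have "((\<lambda>t. prob (N s t) + prob (D \<epsilon> (n s t))) \<longlongrightarrow> G s + 0) F"
      by (intro tendsto_add G_lim' D_lim s \<epsilon>)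
    then have "eventually (\<lambda>t. prob (N s t) + prob (D \<epsilon> (n s t)) < u) F"
      using s by (intro order_tendstoD(2)) auto
    with le show "eventually (\<lambda>t. prob (T t) < u) F"
      by eventually_elim linarith
  qed
  then show ?thesis by (simp add: T_def)
qed

end

section \<open>Passage from the pairs to the marginal sequences, and conclusion\<close>

theorem theorem3:
  fixes M :: "'a measure" and X Y :: "nat \<Rightarrow> 'a \<Rightarrow> real"
    and \<alpha> \<beta> \<gamma> :: "real \<Rightarrow> real" and b c :: "real \<Rightarrow> nat \<Rightarrow> real"
    and g \<mu> :: real and a :: "nat \<Rightarrow> real"
  assumes prob: "prob_space M"
    and indep: "prob_space.indep_vars M (\<lambda>_. borel) (\<lambda>i \<omega>. (X i \<omega>, Y i \<omega>)) {1..}"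
    and ident: "\<And>i. i \<ge> 1 \<Longrightarrow>
      distr M borel (\<lambda>\<omega>. (X i \<omega>, Y i \<omega>)) = distr M borel (\<lambda>\<omega>. (X 1 \<omega>, Y 1 \<omega>))"
    and Y_nonneg: "\<And>i. i \<ge> 1 \<Longrightarrow> AE \<omega> in M. Y i \<omega> \<ge> 0"
    and Y_int: "integrable M (Y 1)"
    and \<mu>: "\<mu> = (\<integral>\<omega>. Y 1 \<omega> \<partial>M)" "\<mu> > 0"
    and endpoint_cont: "\<And>x. ereal x = upper_endpoint M (X 1) \<Longrightarrow> isCont (left_cdf M (X 1)) x"
    and thresholds: "\<And>t. \<gamma> t \<le> \<beta> t" "\<And>t. \<beta> t \<le> \<alpha> t"
    and tail_\<beta>: "\<And>t. tail M (X 1) (\<beta> t) > 0"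
    and \<alpha>_lim: "((\<lambda>t. ereal (\<alpha> t)) \<longlongrightarrow> upper_endpoint M (X 1)) at_top"
    and \<beta>_lim: "((\<lambda>t. ereal (\<beta> t)) \<longlongrightarrow> upper_endpoint M (X 1)) at_top"
    and \<gamma>_lim: "((\<lambda>t. ereal (\<gamma> t)) \<longlongrightarrow> upper_endpoint M (X 1)) at_top"
    and b: "\<And>t. incseq (b t)" "\<And>t. b t 0 = 0" "\<And>t. b t 1 > 0"
    and c: "\<And>t. incseq (c t)" "\<And>t. c t 0 = 0"
    and above_\<beta>: "\<And>t k l. \<alpha> t + b t k - c t l \<ge> \<beta> t"
    and g: "0 < g" "g < 1"
    and g_lim: "((\<lambda>t. tail M (X 1) (\<beta> t) / tail M (X 1) (\<gamma> t)) \<longlongrightarrow> g) at_top"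
    and a: "\<And>h. a h \<in> {0..1}"
    and a_lim: "\<And>k h. ((\<lambda>t. tail M (X 1) (\<alpha> t + b t k - c t h) / tail M (X 1) (\<beta> t)) \<longlongrightarrow> a h) at_top"
  shows "\<forall>z>0.
    ((\<lambda>t. measure M {\<omega> \<in> space M.
        ereal_of_enat (fatal_index (\<gamma> t) (\<beta> t) (\<alpha> t) (b t) (c t) (\<lambda>i. X i \<omega>))
          > ereal (z / tail M (X 1) (\<beta> t))})
      \<longlongrightarrow> 1 - limit_df a z) at_top
    \<and> ((\<lambda>t. measure M {\<omega> \<in> space M.
        shock_time (\<lambda>i. Y i \<omega>) (fatal_index (\<gamma> t) (\<beta> t) (\<alpha> t) (b t) (c t) (\<lambda>i. X i \<omega>))
          > ereal (z / tail M (X 1) (\<beta> t))})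
      \<longlongrightarrow> 1 - limit_df a (z / \<mu>)) at_top"
proof (intro allI impI)
  fix z :: real
  assume z: "z > 0"
  interpret prob_space M by (rule prob)
  have fst_snd [measurable]: "(fst :: real \<times> real \<Rightarrow> real) \<in> borel_measurable borel"
      "(snd :: real \<times> real \<Rightarrow> real) \<in> borel_measurable borel"
    by (intro borel_measurable_continuous_onI continuous_on_fst continuous_on_snd continuous_on_id)+
  have XY: "(\<lambda>\<omega>. (X i \<omega>, Y i \<omega>)) \<in> borel_measurable M" if "i \<ge> 1" for i
    using indep that by (auto simp: indep_vars_def)
  have X: "X i \<in> borel_measurable M" and Y: "Y i \<in> borel_measurable M" if "i \<ge> 1" for i
    using measurable_compose[OF XY[OF that] fst_snd(1)]
      measurable_compose[OF XY[OF that] fst_snd(2)] by simp_all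
  have X_indep: "indep_vars (\<lambda>_. borel) X {1..}"
    using indep_vars_compose2[OF indep, of "\<lambda>_. fst" "\<lambda>_. borel"] by simp
  have Y_indep: "indep_vars (\<lambda>_. borel) Y {1..}"
    using indep_vars_compose2[OF indep, of "\<lambda>_. snd" "\<lambda>_. borel"] by simp
  have compose: "distr M borel (\<lambda>\<omega>. f (X i \<omega>, Y i \<omega>)) = distr (distr M borel (\<lambda>\<omega>. (X i \<omega>, Y i \<omega>))) borel f"
    if "i \<ge> 1" "f \<in> borel_measurable borel" for i and f :: "real \<times> real \<Rightarrow> real"
    using distr_distr[OF that(2) XY[OF that(1)]] by (simp add: comp_def)
  have X_ident: "distr M borel (X i) = distr M borel (X 1)" if "i \<ge> 1" for i
    using compose[OF that, of fst] compose[of 1 fst] ident[OF that] by simp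
  have Y_ident: "distr M borel (Y i) = distr M borel (Y 1)" if "i \<ge> 1" for i
    using compose[OF that, of snd] compose[of 1 snd] ident[OF that] by simp
  let ?p = "\<lambda>t. tail M (X 1) (\<beta> t)"
  let ?\<nu> = "\<lambda>t \<omega>. fatal_index (\<gamma> t) (\<beta> t) (\<alpha> t) (b t) (c t) (\<lambda>i. X i \<omega>)"
  have "((\<lambda>t. left_cdf M (X 1) (\<beta> t)) \<longlongrightarrow> 1) at_top"
    \<comment> \<open>The positive tail at \<open>\<beta> 0\<close> supplies a point where the
      left-continuous distribution function is below 1.\<close>
    using tail_\<beta>[of 0] by (intro left_cdf_tendsto_1[OF X _ endpoint_cont \<beta>_lim]) (auto simp: tail_def)
  from tendsto_diff[OF tendsto_const this, of 1] have p0: "(?p \<longlongrightarrow> 0) at_top"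
    by (simp add: tail_def)
  have \<nu>_lim: "((\<lambda>t. prob {\<omega> \<in> space M. enat (nat \<lfloor>s / ?p t\<rfloor>) < ?\<nu> t \<omega>}) \<longlongrightarrow> 1 - limit_df a s) at_top"
    if "s > 0" for s
    by (rule prob_fatal_index_tendsto[OF X_indep X_ident tail_\<beta> p0 trivial_limit_at_top_linorder
          b(1) above_\<beta> g(1) g_lim a_lim that])
  have "((\<lambda>t. prob {\<omega> \<in> space M. ereal_of_enat (?\<nu> t \<omega>) > ereal (z / ?p t)}) \<longlongrightarrow> 1 - limit_df a z) at_top"
    using \<nu>_lim[OF z] z tail_\<beta> by (simp add: less_ereal_of_enat_iff less_imp_le)
  moreover have "((\<lambda>t. prob {\<omega> \<in> space M. shock_time (\<lambda>i. Y i \<omega>) (?\<nu> t \<omega>) > ereal (z / ?p t)})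
      \<longlongrightarrow> 1 - limit_df a (z / \<mu>)) at_top"
    \<comment> \<open>The function \<open>G\<close> is read off from \<open>\<nu>_lim\<close> as
      \<open>\<lambda>s. 1 - limit_df a s\<close>; the premise left open is its continuity at
      \<open>z / \<mu>\<close>.\<close>
    by (rule prob_shock_time_tendsto[OF Y_indep Y_ident Y_nonneg Y_int \<mu> p0 tail_\<beta>
          less_fatal_index_measurable[OF X] shock_time_fatal_index_measurable[OF X Y] _ \<nu>_lim z])
      (auto intro!: continuous_intros isCont_limit_df a)
  ultimately show "((\<lambda>t. prob {\<omega> \<in> space M. ereal_of_enat (?\<nu> t \<omega>) > ereal (z / ?p t)}) \<longlongrightarrow> 1 - limit_df a z) at_top
    \<and> ((\<lambda>t. prob {\<omega> \<in> space M. shock_time (\<lambda>i. Y i \<omega>) (?\<nu> t \<omega>) > ereal (z / ?p t)})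
      \<longlongrightarrow> 1 - limit_df a (z / \<mu>)) at_top"
    by blast
qed

end
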